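(* For every integer $n\ge 4$ with $n\notin\{6,10,12,14,18,26,30\}$, there exists a Kirkman frame of type $24^n$ which contains as a subdesign a $3$-GDD of type $12^n$ (a Kirkman frame of type $(12;24)^n$).
   Context: A 3-GDD of type $g^u$ on a point set $V$ is a partition of $V$ into $u$ groups of size $g$ together with a set of 3-subsets (blocks) each meeting every group in at most one point, such that any two points in different groups lie in exactly one block. A Kirkman frame is a 3-GDD whose blocks can be partitioned into partial parallel classes, each of which is a partition of $V\setminus V_i$ for some group $V_i$. A Kirkman frame of type $h^u$ (groups $V_1,\dots,V_u$, block set $\mathcal{B}$) contains a 3-GDD of type $g^u$ (groups $W_1,\dots,W_u$, block set $\mathcal{A}$) as a subdesign if $W_i\subseteq V_i$ for all $i$ and $\mathcal{A}\subseteq\mathcal{B}$; this is called a Kirkman frame of type $(g;h)^u$. *)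

theory Defs
  imports "HOL-Library.Disjoint_Sets"
begin

text \<open>Designs have their groups indexed by \<open>{..<u}\<close>, since the subdesign relation pairs the
  groups of the two designs by index.\<close>

text \<open>\<open>gdd3 g u X G B\<close>: \<open>B\<close> is the block set of a 3-GDD of type \<open>g\<^sup>u\<close> on the point set \<open>X\<close> with
  groups \<open>G 0, \<dots>, G (u - 1)\<close>.\<close>

definition gdd3 :: "nat \<Rightarrow> nat \<Rightarrow> 'a set \<Rightarrow> (nat \<Rightarrow> 'a set) \<Rightarrow> 'a set set \<Rightarrow> bool" where
  "gdd3 g u X G B \<longleftrightarrow>
     (\<Union>i<u. G i) = X \<and> disjoint_family_on G {..<u} \<and>
     (\<forall>i<u. finite (G i) \<and> card (G i) = g) \<and>
     (\<forall>b\<in>B. b \<subseteq> X \<and> card b = 3 \<and> (\<forall>i<u. card (b \<inter> G i) \<le> 1)) \<and>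
     (\<forall>i<u. \<forall>j<u. i \<noteq> j \<longrightarrow>
        (\<forall>x\<in>G i. \<forall>y\<in>G j. \<exists>!b. b \<in> B \<and> x \<in> b \<and> y \<in> b))"

definition kirkman_frame ::
    "nat \<Rightarrow> nat \<Rightarrow> 'a set \<Rightarrow> (nat \<Rightarrow> 'a set) \<Rightarrow> 'a set set \<Rightarrow> bool" where
  "kirkman_frame h u X G B \<longleftrightarrow>
     gdd3 h u X G B \<and>
     (\<exists>P. partition_on B P \<and> (\<forall>C\<in>P. \<exists>i<u. partition_on (X - G i) C))"

definition contains_subdesign ::
    "nat \<Rightarrow> (nat \<Rightarrow> 'a set) \<Rightarrow> 'a set set \<Rightarrow> (nat \<Rightarrow> 'a set) \<Rightarrow> 'a set set \<Rightarrow> bool" where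
  "contains_subdesign u V B W A \<longleftrightarrow> (\<forall>i<u. W i \<subseteq> V i) \<and> A \<subseteq> B"

end

theory Submission
  imports Defs "HOL-Library.Nat_Bijection" "HOL-Computational_Algebra.Primes"
begin

text \<open>
  The numbers \<open>n\<close> for which a Kirkman frame of type \<open>(12;24)\<^sup>n\<close> exists are closed under pairwise
  balanced designs: replace each block by a frame and collect, for each point, the classes missing it.
  Transversal designs with groups of size \<open>m\<close> coprime to 6, with two groups truncated and possibly a
  point at infinity, are pairwise balanced with block sizes 4, 5, 6, and they reach every large
  \<open>n = 4 m + a + b\<close> from small \<open>a\<close> and \<open>b\<close>. The small frames come from computer searches: mostly
  cyclic starters for \<open>(12;24)\<^sup>n\<close>, or for \<open>(3;6)\<^sup>n\<close> followed by inflation with a resolvable transversal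
  design. For \<open>n = 4\<close> a frame of type \<open>(4;8)\<^sup>4\<close> is inflated, and for \<open>n = 8\<close> the same frame replaces the
  blocks of a 4-GDD of type \<open>3\<^sup>8\<close>.
\<close>

section \<open>Kirkman frames with a doubled subdesign\<close>

text \<open>A point of a frame of type \<open>(g;2g)^n\<close> lies in \<open>g * (n - 1)\<close>
  blocks, one for each class that does not miss its group. As this number is the same for all
  groups, every group is missed by exactly \<open>g\<close> classes; hence the index set
  \<open>S \<times> {..<g}\<close> of the classes. Two necessary conditions decide which
  \<open>g\<close> are worth a search. A class splits \<open>2 * g * (n - 1)\<close> points into
  triples, so 3 divides \<open>g * (n - 1)\<close>. The blocks of the subdesign through one of its
  points pair off \<open>g * (n - 1)\<close> points, so this number is even. Inflation by
  \<open>m = 12 / g\<close> needs a resolvable transversal design, that is two orthogonal Latin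
  squares of order \<open>m\<close>, which excludes \<open>m = 2\<close> and \<open>m = 6\<close>.
  So \<open>g = 3\<close> is open only to odd \<open>n\<close>, and \<open>g = 4\<close> only to
  \<open>n\<close> with \<open>n mod 3 = 1\<close>. For 6 and 8 no proper divisor \<open>g\<close>
  of 12 survives: 6 is searched at full size \<open>g = 12\<close>, and 8 goes through a
  4-GDD.\<close>

text \<open>\<open>Q\<close> are the points, \<open>\<rho>\<close> assigns to a point its group, and \<open>F k\<close> is the partial parallel class
  that misses the group \<open>\<kappa> k\<close>. The condition on \<open>W\<close> says that the blocks inside \<open>W\<close> already cover all
  pairs of points of \<open>W\<close> in different groups, so that they form the subdesign.\<close>

definition frame ::
    "'p set \<Rightarrow> 'p set \<Rightarrow> ('p \<Rightarrow> 'l) \<Rightarrow> 'k set \<Rightarrow> ('k \<Rightarrow> 'l) \<Rightarrow> ('k \<Rightarrow> 'p set set) \<Rightarrow> bool" where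
  "frame Q W \<rho> K \<kappa> F \<longleftrightarrow>
     (\<forall>k\<in>K. partition_on {p\<in>Q. \<rho> p \<noteq> \<kappa> k} (F k)) \<and>
     (\<forall>k\<in>K. \<forall>b\<in>F k. card b = 3 \<and> inj_on \<rho> b \<and>
        (\<forall>p\<in>b \<inter> W. \<forall>q\<in>b \<inter> W. p \<noteq> q \<longrightarrow> b \<subseteq> W)) \<and>
     (\<forall>p\<in>Q. \<forall>q\<in>Q. \<rho> p \<noteq> \<rho> q \<longrightarrow> (\<exists>k\<in>K. \<exists>b\<in>F k. p \<in> b \<and> q \<in> b)) \<and>
     (\<forall>k\<in>K. \<forall>k'\<in>K. \<forall>b\<in>F k. \<forall>b'\<in>F k'. \<forall>p\<in>b \<inter> b'. \<forall>q\<in>b \<inter> b'.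
        p \<noteq> q \<longrightarrow> k = k' \<and> b = b')"

lemma
  assumes "frame Q W \<rho> K \<kappa> F"
  shows frame_partition: "k \<in> K \<Longrightarrow> partition_on {p\<in>Q. \<rho> p \<noteq> \<kappa> k} (F k)"
    and frame_card: "k \<in> K \<Longrightarrow> b \<in> F k \<Longrightarrow> card b = 3"
    and frame_inj: "k \<in> K \<Longrightarrow> b \<in> F k \<Longrightarrow> inj_on \<rho> b"
    and frame_sub: "k \<in> K \<Longrightarrow> b \<in> F k \<Longrightarrow> p \<in> b \<Longrightarrow> q \<in> b \<Longrightarrow> p \<in> W \<Longrightarrow> q \<in> W \<Longrightarrow> p \<noteq> q \<Longrightarrow> b \<subseteq> W"
    and frame_ex: "p \<in> Q \<Longrightarrow> q \<in> Q \<Longrightarrow> \<rho> p \<noteq> \<rho> q \<Longrightarrow> \<exists>k\<in>K. \<exists>b\<in>F k. p \<in> b \<and> q \<in> b"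
proof -
  note * = assms[unfolded frame_def]
  show "k \<in> K \<Longrightarrow> partition_on {p\<in>Q. \<rho> p \<noteq> \<kappa> k} (F k)"
    "k \<in> K \<Longrightarrow> b \<in> F k \<Longrightarrow> card b = 3" "k \<in> K \<Longrightarrow> b \<in> F k \<Longrightarrow> inj_on \<rho> b"
    using * by simp_all
  show "k \<in> K \<Longrightarrow> b \<in> F k \<Longrightarrow> p \<in> b \<Longrightarrow> q \<in> b \<Longrightarrow> p \<in> W \<Longrightarrow> q \<in> W \<Longrightarrow> p \<noteq> q \<Longrightarrow> b \<subseteq> W"
    using *[THEN conjunct2, THEN conjunct1] by (meson IntI)
  show "p \<in> Q \<Longrightarrow> q \<in> Q \<Longrightarrow> \<rho> p \<noteq> \<rho> q \<Longrightarrow> \<exists>k\<in>K. \<exists>b\<in>F k. p \<in> b \<and> q \<in> b"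
    using * by simp
qed

lemma frame_uniq:
  assumes "frame Q W \<rho> K \<kappa> F" "k \<in> K" "k' \<in> K" "b \<in> F k" "b' \<in> F k'"
    "p \<in> b" "p \<in> b'" "q \<in> b" "q \<in> b'" "p \<noteq> q"
  shows "k = k' \<and> b = b'"
  using assms(1)[unfolded frame_def, THEN conjunct2, THEN conjunct2, THEN conjunct2] assms(2-)
  by (meson IntI)

lemma frame_subset:
  assumes "frame Q W \<rho> K \<kappa> F" "k \<in> K" "b \<in> F k"
  shows "b \<subseteq> {p\<in>Q. \<rho> p \<noteq> \<kappa> k}"
  using frame_partition[OF assms(1,2)] assms(3) by (auto simp: partition_on_def)

lemma partition_on_image:
  assumes P: "partition_on A P" and f: "inj_on f A"
  shows "partition_on (f ` A) ((`) f ` P)"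
proof -
  have "{} \<notin> (`) f ` P" using P by (auto simp: partition_on_def)
  thus ?thesis using partition_on_inj_image[OF P f] by simp
qed

text \<open>Points are pushed forward along \<open>f\<close>, class indices are pulled back along
  \<open>h\<close>, and groups are renamed by \<open>\<sigma>\<close>. Injectivity of
  \<open>\<sigma>\<close> on a set that also contains the labels \<open>\<kappa> k\<close> preserves
  which group a class misses.\<close>

lemma frame_transport:
  assumes fr: "frame Q W \<rho> K \<kappa> F" and WQ: "W \<subseteq> Q" and f: "inj_on f Q"
    and h: "bij_betw h K' K" and \<sigma>: "inj_on \<sigma> S" "\<rho> ` Q \<subseteq> S" "\<kappa> ` K \<subseteq> S"
    and \<rho>': "\<And>p. p \<in> Q \<Longrightarrow> \<rho>' (f p) = \<sigma> (\<rho> p)"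
    and \<kappa>': "\<And>k. k \<in> K' \<Longrightarrow> \<kappa>' k = \<sigma> (\<kappa> (h k))"
  shows "frame (f ` Q) (f ` W) \<rho>' K' \<kappa>' (\<lambda>k. (`) f ` F (h k))"
proof -
  have hK: "h k \<in> K" if "k \<in> K'" for k using h that by (auto simp: bij_betw_def)
  have bQ: "b \<subseteq> Q" if "k \<in> K" "b \<in> F k" for k b
    using frame_subset[OF fr that] by auto
  have lab: "\<rho>' (f p) = \<rho>' (f q) \<longleftrightarrow> \<rho> p = \<rho> q" if "p \<in> Q" "q \<in> Q" for p q
    using that \<sigma>(1,2) by (auto simp: \<rho>' inj_on_eq_iff image_subset_iff)
  have labk: "\<rho>' (f p) = \<kappa>' k \<longleftrightarrow> \<rho> p = \<kappa> (h k)" if "p \<in> Q" "k \<in> K'" for p k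
    using that \<sigma> hK by (auto simp: \<rho>' \<kappa>' inj_on_eq_iff image_subset_iff)
  show ?thesis
    unfolding frame_def
  proof (intro conjI ballI impI)
    fix k assume k: "k \<in> K'"
    have "{p \<in> f ` Q. \<rho>' p \<noteq> \<kappa>' k} = f ` {p\<in>Q. \<rho> p \<noteq> \<kappa> (h k)}"
      using k by (auto simp: labk)
    thus "partition_on {p \<in> f ` Q. \<rho>' p \<noteq> \<kappa>' k} ((`) f ` F (h k))"
      using partition_on_image[OF frame_partition[OF fr hK[OF k]], of f] f
      by (simp add: inj_on_def)
  next
    fix k B assume k: "k \<in> K'" and "B \<in> (`) f ` F (h k)"
    then obtain b where b: "b \<in> F (h k)" "B = f ` b" by auto
    have bq: "b \<subseteq> Q" using bQ[OF hK[OF k] b(1)] .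
    show "card B = 3" using frame_card[OF fr hK[OF k] b(1)] card_image[OF inj_on_subset[OF f bq]] b(2)
      by simp
    show "inj_on \<rho>' B"
      unfolding b(2)
    proof (rule inj_onI, elim imageE)
      fix x y u v assume "\<rho>' x = \<rho>' y" "x = f u" "y = f v" "u \<in> b" "v \<in> b"
      then show "x = y"
        using lab[of u v] bq frame_inj[OF fr hK[OF k] b(1)] by (auto simp: inj_on_eq_iff)
    qed
    fix p q assume pq: "p \<in> B \<inter> f ` W" "q \<in> B \<inter> f ` W" "p \<noteq> q"
    obtain x y where xy: "p = f x" "q = f y" "x \<in> W" "y \<in> W"
      using pq by auto
    then have "x \<in> b" "y \<in> b"
      using pq bq WQ f inj_on_image_mem_iff[of f Q] unfolding b(2) by blast+
    then have "b \<subseteq> W"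
      using frame_sub[OF fr hK[OF k] b(1), of x y] pq(3) xy by auto
    then show "B \<subseteq> f ` W" unfolding b(2) by (rule image_mono)
  next
    fix p q assume "p \<in> f ` Q" "q \<in> f ` Q" "\<rho>' p \<noteq> \<rho>' q"
    then obtain x y where xy: "p = f x" "q = f y" "x \<in> Q" "y \<in> Q" "\<rho> x \<noteq> \<rho> y"
      by (auto simp: lab)
    obtain k b where kb: "k \<in> K" "b \<in> F k" "x \<in> b" "y \<in> b"
      using frame_ex[OF fr xy(3-5)] by blast
    obtain k' where "k' \<in> K'" "h k' = k" using h kb(1) by (auto simp: bij_betw_def)
    thus "\<exists>k\<in>K'. \<exists>b\<in>(`) f ` F (h k). p \<in> b \<and> q \<in> b"
      using kb xy by blast
  next
    fix k k' B B' p q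
    assume k: "k \<in> K'" "k' \<in> K'" and B: "B \<in> (`) f ` F (h k)" "B' \<in> (`) f ` F (h k')"
      and p: "p \<in> B \<inter> B'" and q: "q \<in> B \<inter> B'" and "p \<noteq> q"
    obtain b b' where b: "b \<in> F (h k)" "B = f ` b" "b' \<in> F (h k')" "B' = f ` b'" using B by auto
    have *: "\<exists>x. x \<in> b \<and> x \<in> b' \<and> z = f x" if "z \<in> B \<inter> B'" for z
      using that b bQ[OF hK[OF k(1)] b(1)] bQ[OF hK[OF k(2)] b(3)] f
      by (auto simp: inj_on_eq_iff subset_iff)
    obtain x y where "x \<in> b" "x \<in> b'" "p = f x" "y \<in> b" "y \<in> b'" "q = f y"
      using *[OF p] *[OF q] by blast
    then have "h k = h k' \<and> b = b'"
      using frame_uniq[OF fr hK[OF k(1)] hK[OF k(2)] b(1,3), of x y] \<open>p \<noteq> q\<close> by blast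
    thus "k = k'" "B = B'" using h k b by (auto simp: bij_betw_def inj_on_eq_iff)
  qed
qed

text \<open>A Kirkman frame of type \<open>(g;2g)\<close> with groups indexed by \<open>S\<close>; every group is missed by exactly
  \<open>g\<close> of the partial parallel classes.\<close>

definition has_frame :: "nat \<Rightarrow> 'l set \<Rightarrow> bool" where
  "has_frame g S \<longleftrightarrow> (\<exists>F. frame (S \<times> {..<2 * g}) (S \<times> {..<g}) fst (S \<times> {..<g}) fst F)"

lemma ex_bij_fibres:
  fixes g :: nat
  assumes "\<And>i. i \<in> S \<Longrightarrow> card {p\<in>Q. \<rho> p = i} = g" and "\<rho> ` Q \<subseteq> S" and "g > 0"
    and \<sigma>: "bij_betw \<sigma> S S'"
  shows "\<exists>f. bij_betw f Q (S' \<times> {..<g}) \<and> (\<forall>p\<in>Q. fst (f p) = \<sigma> (\<rho> p))"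
proof -
  have "\<exists>e. bij_betw e {p\<in>Q. \<rho> p = i} {..<g}" if "i \<in> S" for i
  proof -
    \<comment> \<open>\<open>card\<close> is 0 on infinite sets, so a fibre of positive size is
      finite.\<close>
    have "finite {p\<in>Q. \<rho> p = i}" using assms(1)[OF that] \<open>g > 0\<close> by (metis card.infinite less_irrefl)
    thus ?thesis using assms(1)[OF that] ex_bij_betw_finite_nat by (metis atLeast0LessThan)
  qed
  then obtain e where e: "\<And>i. i \<in> S \<Longrightarrow> bij_betw (e i) {p\<in>Q. \<rho> p = i} {..<g}" by metis
  define f where "f p = (\<sigma> (\<rho> p), e (\<rho> p) p)" for p
  have "bij_betw f Q (S' \<times> {..<g})"
  proof (rule bij_betwI')
    fix x y assume xy: "x \<in> Q" "y \<in> Q"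
    then have S: "\<rho> x \<in> S" "\<rho> y \<in> S" using assms(2) by auto
    show "(f x = f y) = (x = y)"
    proof
      assume "f x = f y"
      then have "\<rho> x = \<rho> y" "e (\<rho> x) x = e (\<rho> x) y"
        using S \<sigma> by (auto simp: f_def bij_betw_def inj_on_eq_iff)
      then show "x = y" using e[OF S(1)] xy by (auto simp: bij_betw_def inj_on_def)
    qed simp
  next
    fix x assume x: "x \<in> Q"
    then have "\<rho> x \<in> S" using assms(2) by auto
    then show "f x \<in> S' \<times> {..<g}"
      using e[of "\<rho> x"] \<sigma> x by (auto simp: f_def bij_betw_def)
  next
    fix z assume "z \<in> S' \<times> {..<g}"
    then obtain i j where z: "z = (\<sigma> i, j)" "i \<in> S" "j < g" using \<sigma> by (auto simp: bij_betw_def)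
    then have "j \<in> e i ` {p\<in>Q. \<rho> p = i}" using e[OF z(2)] by (simp add: bij_betw_def)
    then obtain x where "x \<in> Q" "\<rho> x = i" "e i x = j" by auto
    thus "\<exists>x\<in>Q. z = f x" using z by (auto simp: f_def)
  qed
  thus ?thesis by (auto simp: f_def)
qed

text \<open>Only fibre sizes matter: \<open>W\<close>, its complement and the class indices can each
  be enumerated group by group, which puts any such frame into the coordinates of
  \<open>has_frame\<close>, with \<open>W\<close> as the lower half. Gluing, inflation, starters and
  explicit frames all end here.\<close>

lemma has_frameI:
  assumes fr: "frame Q W \<rho> K \<kappa> F" and WQ: "W \<subseteq> Q" and S: "\<rho> ` Q \<subseteq> S" "\<kappa> ` K \<subseteq> S"
    and Q: "\<And>i. i \<in> S \<Longrightarrow> card {p\<in>Q. \<rho> p = i} = 2 * g"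
    and W: "\<And>i. i \<in> S \<Longrightarrow> card {p\<in>W. \<rho> p = i} = g"
    and K: "\<And>i. i \<in> S \<Longrightarrow> card {k\<in>K. \<kappa> k = i} = g"
    and g: "g > 0" and \<sigma>: "bij_betw \<sigma> S S'"
  shows "has_frame g S'"
proof -
  have W': "\<rho> ` W \<subseteq> S" "\<rho> ` (Q - W) \<subseteq> S" using S WQ by blast+
  have QW: "card {p\<in>Q - W. \<rho> p = i} = g" if "i \<in> S" for i
  proof -
    have fin: "finite {p\<in>W. \<rho> p = i}" using W[OF that] g by (metis card.infinite less_irrefl)
    have "{p\<in>Q - W. \<rho> p = i} = {p\<in>Q. \<rho> p = i} - {p\<in>W. \<rho> p = i}" by auto
    then show ?thesis using card_Diff_subset[OF fin, of "{p\<in>Q. \<rho> p = i}"] WQ W[OF that] Q[OF that]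
      by auto
  qed
  obtain f1 where f1: "bij_betw f1 W (S' \<times> {..<g})" "\<forall>p\<in>W. fst (f1 p) = \<sigma> (\<rho> p)"
    using ex_bij_fibres[OF W W'(1) g \<sigma>] by blast
  obtain f2 where f2: "bij_betw f2 (Q - W) (S' \<times> {..<g})" "\<forall>p\<in>Q - W. fst (f2 p) = \<sigma> (\<rho> p)"
    using ex_bij_fibres[OF QW W'(2) g \<sigma>] by blast
  obtain h' where h': "bij_betw h' K (S' \<times> {..<g})" "\<forall>k\<in>K. fst (h' k) = \<sigma> (\<kappa> k)"
    using ex_bij_fibres[OF K S(2) g \<sigma>] by blast
  \<comment> \<open>\<open>frame_transport\<close> reads old class indices off new ones, hence the
    inverse.\<close>
  define h where "h = inv_into K h'"
  have h: "bij_betw h (S' \<times> {..<g}) K" "\<And>k. k \<in> S' \<times> {..<g} \<Longrightarrow> fst k = \<sigma> (\<kappa> (h k))"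
  proof -
    show b: "bij_betw h (S' \<times> {..<g}) K" using h'(1) unfolding h_def by (rule bij_betw_inv_into)
    fix k assume k: "k \<in> S' \<times> {..<g}"
    then have "h k \<in> K" "h' (h k) = k"
      using b h'(1) by (auto simp: bij_betw_def h_def f_inv_into_f)
    then show "fst k = \<sigma> (\<kappa> (h k))" using h'(2) by metis
  qed
  define sh where "sh = (\<lambda>(i::'d, w::nat). (i, w + g))"
  have sh: "bij_betw sh (S' \<times> {..<g}) (S' \<times> {g..<2*g})"
  proof -
    have "(i, w) \<in> sh ` (S' \<times> {..<g})" if "i \<in> S'" "g \<le> w" "w < 2*g" for i w
      by (rule image_eqI[of _ _ "(i, w - g)"]) (use that in \<open>auto simp: sh_def\<close>)
    then show ?thesis by (auto simp: bij_betw_def inj_on_def sh_def)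
  qed
  define f where "f p = (if p \<in> W then f1 p else sh (f2 p))" for p
  have bW: "bij_betw f W (S' \<times> {..<g})"
    using f1(1) by (simp add: f_def cong: bij_betw_cong)
  have bQW: "bij_betw f (Q - W) (S' \<times> {g..<2*g})"
  proof -
    have "bij_betw (sh \<circ> f2) (Q - W) (S' \<times> {g..<2*g})" using f2(1) sh by (rule bij_betw_trans)
    thus ?thesis by (rule bij_betw_cong[THEN iffD1, rotated]) (simp add: f_def)
  qed
  have bQ: "bij_betw f Q (S' \<times> {..<2*g})"
  proof -
    have "bij_betw f (W \<union> (Q - W)) (S' \<times> {..<g} \<union> S' \<times> {g..<2*g})"
      using bW bQW by (rule bij_betw_combine) auto
    moreover have "W \<union> (Q - W) = Q" using WQ by auto
    moreover have "S' \<times> {..<g} \<union> S' \<times> {g..<2*g} = S' \<times> {..<2*g}" by auto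
    ultimately show ?thesis by simp
  qed
  have lab: "fst (f p) = \<sigma> (\<rho> p)" if "p \<in> Q" for p
    using that f1(2) f2(2) by (auto simp: f_def sh_def split: prod.splits) (metis DiffI fst_conv)
  have "frame (f ` Q) (f ` W) fst (S' \<times> {..<g}) fst (\<lambda>k. (`) f ` F (h k))"
    using fr WQ bij_betw_imp_inj_on[OF bQ] h(1) bij_betw_imp_inj_on[OF \<sigma>] S lab h(2)
    by (rule frame_transport)
  thus ?thesis unfolding has_frame_def using bQ bW by (auto simp: bij_betw_def)
qed

lemma card_fst_fibre: "i \<in> S \<Longrightarrow> card {p \<in> S \<times> A. fst p = i} = card A"
proof -
  assume "i \<in> S"
  then have "{p \<in> S \<times> A. fst p = i} = Pair i ` A" by auto
  thus ?thesis by (simp add: card_image inj_on_def)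
qed

lemma has_frame_bij:
  assumes "has_frame g S" "bij_betw \<sigma> S S'" "g > 0"
  shows "has_frame g S'"
proof -
  obtain F where F: "frame (S \<times> {..<2 * g}) (S \<times> {..<g}) fst (S \<times> {..<g}) fst F"
    using assms(1) unfolding has_frame_def by blast
  show ?thesis
    by (rule has_frameI[OF F _ _ _ _ _ _ assms(3,2)]) (auto simp: card_fst_fibre)
qed

text \<open>The blocks of the subdesign are those contained in \<open>W\<close>: two points of
  \<open>W\<close> in different groups lie in a block of the frame, and \<open>frame_sub\<close>
  forces this block into \<open>W\<close>. \<open>prod_encode\<close> only moves the points into
  \<open>nat\<close>.\<close>

lemma contains_subdesign_if_has_frame:
  assumes has_frame: "has_frame 12 {..<n}" and n: "n \<ge> 2"
  shows "\<exists>(X :: nat set) V B Y W A.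
           kirkman_frame 24 n X V B \<and> gdd3 12 n Y W A \<and> contains_subdesign n V B W A"
proof -
  obtain F0 where F0: "frame ({..<n} \<times> {..<24::nat}) ({..<n} \<times> {..<12::nat}) fst ({..<n} \<times> {..<12::nat}) fst F0"
    using has_frame unfolding has_frame_def by auto
  define \<rho> :: "nat \<Rightarrow> nat" where "\<rho> = (\<lambda>p. fst (prod_decode p))"
  define Q where "Q = prod_encode ` ({..<n} \<times> {..<24})"
  define W where "W = prod_encode ` ({..<n} \<times> {..<12})"
  define K where "K = {..<n} \<times> {..<12::nat}"
  obtain F where fr: "frame Q W \<rho> K fst F"
  proof
    show "frame Q W \<rho> K fst (\<lambda>k. (`) prod_encode ` F0 k)"
      unfolding Q_def W_def K_def
      by (rule frame_transport[OF F0, where \<sigma> = "\<lambda>x. x" and S = UNIV and h = "\<lambda>x. x"])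
        (auto simp: \<rho>_def inj_on_def bij_betw_def)
  qed
  define V where "V i = {p\<in>Q. \<rho> p = i}" for i
  define W' where "W' i = {p\<in>W. \<rho> p = i}" for i
  define B where "B = (\<Union>k\<in>K. F k)"
  have WQ: "W \<subseteq> Q" unfolding Q_def W_def by auto
  have \<rho>n: "\<rho> p < n" if "p \<in> Q" for p using that by (auto simp: Q_def \<rho>_def)
  have Veq: "V i = prod_encode ` ({i} \<times> {..<24})" if "i < n" for i
    using that by (auto simp: V_def Q_def \<rho>_def)
  have Weq: "W' i = prod_encode ` ({i} \<times> {..<12})" if "i < n" for i
    using that by (auto simp: W'_def W_def \<rho>_def)
  have Vc: "finite (V i)" "card (V i) = 24" if "i < n" for i
    using that by (simp_all add: Veq card_image inj_prod_encode)
  have Wc: "finite (W' i)" "card (W' i) = 12" if "i < n" for i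
    using that by (simp_all add: Weq card_image inj_prod_encode)
  have BQ: "b \<subseteq> Q" "card b = 3" "inj_on \<rho> b" if "b \<in> B" for b
    using that frame_subset[OF fr] frame_card[OF fr] frame_inj[OF fr] by (auto simp: B_def)
  have le1: "card (b \<inter> V i) \<le> 1" if "b \<in> B" for b i
  proof -
    have "x = y" if "x \<in> b \<inter> V i" "y \<in> b \<inter> V i" for x y
      using BQ(3)[OF \<open>b \<in> B\<close>] that by (auto simp: V_def inj_on_def)
    then show ?thesis by (simp add: card_le_Suc0_iff_eq card_ge_0_finite BQ(2)[OF \<open>b \<in> B\<close>])
  qed
  have uniq: "b = b'" if "b \<in> B" "b' \<in> B" "p \<in> b" "q \<in> b" "p \<in> b'" "q \<in> b'" "p \<noteq> q" for b b' p q
    using that frame_uniq[OF fr] unfolding B_def by blast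
  have ex: "\<exists>b\<in>B. p \<in> b \<and> q \<in> b" if "p \<in> Q" "q \<in> Q" "\<rho> p \<noteq> \<rho> q" for p q
    using frame_ex[OF fr that] unfolding B_def by blast
  have sub: "b \<subseteq> W" if "b \<in> B" "p \<in> b" "q \<in> b" "p \<in> W" "q \<in> W" "p \<noteq> q" for b p q
    using frame_sub[OF fr] that unfolding B_def by blast
  have gV: "gdd3 24 n Q V B"
    unfolding gdd3_def
  proof (intro conjI allI ballI impI)
    show "(\<Union>i<n. V i) = Q" using \<rho>n by (auto simp: V_def)
    show "disjoint_family_on V {..<n}" by (auto simp: V_def disjoint_family_on_def)
    fix i j p q assume "i < n" "j < n" "i \<noteq> j" "p \<in> V i" "q \<in> V j"
    then have "p \<in> Q" "q \<in> Q" "\<rho> p \<noteq> \<rho> q" by (auto simp: V_def)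
    then show "\<exists>!b. b \<in> B \<and> p \<in> b \<and> q \<in> b" using ex uniq by metis
  qed (use Vc BQ le1 in auto)
  have gW: "gdd3 12 n W W' {b\<in>B. b \<subseteq> W}"
    unfolding gdd3_def
  proof (intro conjI allI ballI impI)
    show "(\<Union>i<n. W' i) = W" using \<rho>n WQ by (auto simp: W'_def)
    show "disjoint_family_on W' {..<n}" by (auto simp: W'_def disjoint_family_on_def)
    fix b i assume "b \<in> {b\<in>B. b \<subseteq> W}"
    then have b: "b \<in> B" by simp
    have "finite b" using BQ(2)[OF b] by (simp add: card_ge_0_finite)
    then have "card (b \<inter> W' i) \<le> card (b \<inter> V i)"
      using WQ by (intro card_mono) (auto simp: V_def W'_def)
    then show "card (b \<inter> W' i) \<le> 1" using le1[OF b, of i] by simp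
  next
    fix i j p q assume "i < n" "j < n" "i \<noteq> j" "p \<in> W' i" "q \<in> W' j"
    then have p: "p \<in> W" "q \<in> W" "\<rho> p \<noteq> \<rho> q" by (auto simp: W'_def)
    then obtain b where "b \<in> B" "p \<in> b" "q \<in> b" using ex[of p q] WQ by blast
    then show "\<exists>!b. b \<in> {b\<in>B. b \<subseteq> W} \<and> p \<in> b \<and> q \<in> b"
      using uniq[of _ b p q] sub[of b p q] p by (intro ex1I[of _ b]) blast+
  qed (use Wc BQ in auto)
  have "kirkman_frame 24 n Q V B"
    unfolding kirkman_frame_def
  proof (intro conjI gV exI[of _ "F ` K"])
    show "\<forall>C\<in>F ` K. \<exists>i<n. partition_on (Q - V i) C"
    proof
      fix C assume "C \<in> F ` K"
      then obtain k where k: "k \<in> K" "C = F k" by auto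
      have "Q - V (fst k) = {p\<in>Q. \<rho> p \<noteq> fst k}" by (auto simp: V_def)
      then have "partition_on (Q - V (fst k)) C" using frame_partition[OF fr k(1)] k(2) by simp
      moreover have "fst k < n" using k(1) by (auto simp: K_def)
      ultimately show "\<exists>i<n. partition_on (Q - V i) C" by blast
    qed
    show "partition_on B (F ` K)"
    proof (rule partition_onI)
      show "\<Union> (F ` K) = B" by (simp add: B_def)
      \<comment> \<open>\<open>partition_on\<close> admits no empty member, so every class must be
        nonempty; this takes a group other than the missed one, hence
        \<open>n \<ge> 2\<close>.\<close>
      have "F k \<noteq> {}" if "k \<in> K" for k
      proof
        assume "F k = {}"
        then have *: "{p\<in>Q. \<rho> p \<noteq> fst k} = {}" using frame_partition[OF fr that] by (simp add: partition_on_def)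
        obtain i where i: "i < n" "i \<noteq> fst k"
        proof (cases "fst k = 0")
          case True
          show ?thesis by (rule that[of 1]) (use n True in auto)
        next
          case False
          show ?thesis by (rule that[of 0]) (use n False in auto)
        qed
        have "prod_encode (i, 0) \<in> {p\<in>Q. \<rho> p \<noteq> fst k}" using i by (auto simp: Q_def \<rho>_def)
        then show False unfolding * by simp
      qed
      then show "{} \<notin> F ` K" by auto
      fix C D assume "C \<in> F ` K" "D \<in> F ` K" "C \<noteq> D"
      then obtain k k' where k: "k \<in> K" "k' \<in> K" "C = F k" "D = F k'" by auto
      show "disjnt C D" unfolding disjnt_iff
      proof (intro allI notI, elim conjE)
        fix b assume b: "b \<in> C" "b \<in> D"
        have "card b = 3" using frame_card[OF fr k(1)] b k(3) by simp
        \<comment> \<open>Two points of a shared block already determine the class index.\<close>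
        then obtain p q r where "b = {p, q, r}" "p \<noteq> q" by (auto simp: card_3_iff)
        then have "k = k'" using frame_uniq[OF fr k(1,2), of b b p q] b k by auto
        with k \<open>C \<noteq> D\<close> show False by simp
      qed
    qed
  qed
  moreover have "contains_subdesign n V B W' {b\<in>B. b \<subseteq> W}"
    using WQ by (auto simp: contains_subdesign_def V_def W'_def)
  ultimately show ?thesis using gW by blast
qed

section \<open>Replacing the blocks of a design by frames\<close>

text \<open>With at most one group every class has to cover the empty set, and no pair needs a
  block. Truncation to groups of size 0 and 1 makes this case necessary.\<close>

lemma has_frame_trivial:
  assumes "\<And>x y. x \<in> S \<Longrightarrow> y \<in> S \<Longrightarrow> x = y"
  shows "has_frame g S"
proof -
  have "{p \<in> S \<times> {..<2*g}. fst p \<noteq> fst k} = {}" if "k \<in> S \<times> {..<g}" for k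
    using that assms by auto
  then have empty: "partition_on {p \<in> S \<times> {..<2*g}. fst p \<noteq> fst k} {}" if "k \<in> S \<times> {..<g}" for k
    using that by (simp only: partition_on_empty)
  have "frame (S \<times> {..<2 * g}) (S \<times> {..<g}) fst (S \<times> {..<g}) fst (\<lambda>_. {})"
    unfolding frame_def
  proof (intro conjI ballI impI)
    fix p q assume "p \<in> S \<times> {..<2*g}" "q \<in> S \<times> {..<2*g}" "fst p \<noteq> fst q"
    then show "\<exists>k\<in>S \<times> {..<g}. \<exists>b\<in>{}. p \<in> b \<and> q \<in> b"
      using assms[of "fst p" "fst q"] by (auto simp: mem_Times_iff)
  qed (simp_all add: empty del: mem_Sigma_iff)
  thus ?thesis unfolding has_frame_def by blast
qed

text \<open>Wilson's fundamental construction. The blocks through \<open>x\<close> cover each point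
  outside the group of \<open>x\<close> exactly once and no other point of that group. On such a
  block \<open>L\<close> the class \<open>(x, c)\<close> of its frame covers the copies of
  \<open>L - {x}\<close>, so the union over these \<open>L\<close> is a class that misses the whole
  group of \<open>x\<close>. A group of \<open>t\<close> points thus gets \<open>g * t\<close>
  classes, as it should.\<close>

lemma has_frame_gdd:
  assumes sub: "\<And>L. L \<in> \<L> \<Longrightarrow> L \<subseteq> X" and inj: "\<And>L. L \<in> \<L> \<Longrightarrow> inj_on l L"
    and has_frame: "\<And>L. L \<in> \<L> \<Longrightarrow> has_frame g L"
    and ex: "\<And>x y. x \<in> X \<Longrightarrow> y \<in> X \<Longrightarrow> l x \<noteq> l y \<Longrightarrow> \<exists>L\<in>\<L>. x \<in> L \<and> y \<in> L"
    and uniq: "\<And>x y L L'. x \<noteq> y \<Longrightarrow> L \<in> \<L> \<Longrightarrow> L' \<in> \<L> \<Longrightarrow> x \<in> L \<Longrightarrow> y \<in> L \<Longrightarrow>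
       x \<in> L' \<Longrightarrow> y \<in> L' \<Longrightarrow> L = L'"
    and l: "l ` X \<subseteq> S" "\<And>i. i \<in> S \<Longrightarrow> card {x\<in>X. l x = i} = t" and pos: "t > 0" "g > 0"
  shows "has_frame (g * t) S"
proof -
  obtain F where F: "\<And>L. L \<in> \<L> \<Longrightarrow>
      frame (L \<times> {..<2 * g}) (L \<times> {..<g}) fst (L \<times> {..<g}) fst (F L)"
    using has_frame unfolding has_frame_def by metis
  define H where "H k = (\<Union>L\<in>{L\<in>\<L>. fst k \<in> L}. F L k)" for k :: "'a \<times> nat"
  have bsub: "b \<subseteq> {p \<in> L \<times> {..<2*g}. fst p \<noteq> fst k}" if "L \<in> \<L>" "k \<in> L \<times> {..<g}" "b \<in> F L k" for L b k
    using frame_subset[OF F[OF that(1)] that(2,3)] by simp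
  \<comment> \<open>A block of a frame has at most one point in each group, so \<open>p\<close> and
    \<open>q\<close> project to different points of \<open>X\<close>, and these determine
    \<open>L\<close>.\<close>
  have same: "L = L'" if "L \<in> \<L>" "L' \<in> \<L>" "k \<in> L \<times> {..<g}" "k' \<in> L' \<times> {..<g}"
      "b \<in> F L k" "b' \<in> F L' k'" "p \<in> b" "q \<in> b" "p \<in> b'" "q \<in> b'" "p \<noteq> q" for L L' k k' b b' p q
  proof -
    have "fst p \<noteq> fst q" using frame_inj[OF F[OF that(1)] that(3,5)] that by (auto simp: inj_on_def)
    moreover have "fst p \<in> L" "fst q \<in> L" "fst p \<in> L'" "fst q \<in> L'"
      using bsub[OF that(1,3,5)] bsub[OF that(2,4,6)] that by auto
    ultimately show ?thesis using uniq that(1,2) by blast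
  qed
  have ldiff: "l x \<noteq> l y" if "L \<in> \<L>" "x \<in> L" "y \<in> L" "x \<noteq> y" for L x y
    using inj[OF that(1)] that by (auto simp: inj_on_def)
  have fr: "frame (X \<times> {..<2 * g}) (X \<times> {..<g}) (l \<circ> fst) (X \<times> {..<g}) (l \<circ> fst) H"
    unfolding frame_def o_def
  proof (intro conjI ballI impI)
    fix k assume k: "k \<in> X \<times> {..<g}"
    have kL: "k \<in> L \<times> {..<g}" if "fst k \<in> L" for L using k that by auto
    have P: "partition_on {p \<in> L \<times> {..<2*g}. fst p \<noteq> fst k} (F L k)" if "L \<in> \<L>" "fst k \<in> L" for L
      using frame_partition[OF F[OF that(1)] kL[OF that(2)]] .
    show "partition_on {p \<in> X \<times> {..<2*g}. l (fst p) \<noteq> l (fst k)} (H k)"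
    proof (rule partition_onI)
      show "\<Union> (H k) = {p \<in> X \<times> {..<2*g}. l (fst p) \<noteq> l (fst k)}"
      proof (intro equalityI subsetI)
        fix p assume "p \<in> \<Union> (H k)"
        then obtain L b where L: "L \<in> \<L>" "fst k \<in> L" "b \<in> F L k" "p \<in> b" by (auto simp: H_def)
        then have "p \<in> L \<times> {..<2*g}" "fst p \<noteq> fst k" using bsub[OF L(1) kL[OF L(2)] L(3)] by auto
        then show "p \<in> {p \<in> X \<times> {..<2*g}. l (fst p) \<noteq> l (fst k)}"
          using sub[OF L(1)] ldiff[OF L(1) _ L(2), of "fst p"] by auto
      next
        fix p assume p: "p \<in> {p \<in> X \<times> {..<2*g}. l (fst p) \<noteq> l (fst k)}"
        then obtain L where L: "L \<in> \<L>" "fst p \<in> L" "fst k \<in> L" using ex[of "fst p" "fst k"] k by auto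
        then have "p \<in> \<Union> (F L k)" using P[OF L(1,3), THEN partition_onD1] p by auto
        then show "p \<in> \<Union> (H k)" using L by (auto simp: H_def)
      qed
      show "{} \<notin> H k" using P by (auto simp: H_def partition_on_def)
      fix b b' assume b: "b \<in> H k" "b' \<in> H k" "b \<noteq> b'"
      obtain L L' where L: "L \<in> \<L>" "fst k \<in> L" "b \<in> F L k" "L' \<in> \<L>" "fst k \<in> L'" "b' \<in> F L' k"
        using b by (auto simp: H_def)
      show "disjnt b b'"
      proof (cases "L = L'")
        case True
        then show ?thesis using P[OF L(1,2)] L b by (auto simp: partition_on_def pairwise_def)
      next
        case False
        show ?thesis unfolding disjnt_iff
        proof (intro allI notI, elim conjE)
          fix p assume "p \<in> b" "p \<in> b'"
          then have "fst p \<in> L" "fst p \<in> L'" "fst p \<noteq> fst k"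
            using bsub[OF L(1) kL[OF L(2)] L(3)] bsub[OF L(4) kL[OF L(5)] L(6)] by auto
          with uniq[OF this(3) L(1,4)] L False show False by blast
        qed
      qed
    qed
  next
    fix k b assume "k \<in> X \<times> {..<g}" "b \<in> H k"
    then obtain L where L: "L \<in> \<L>" "k \<in> L \<times> {..<g}" "b \<in> F L k" by (auto simp: H_def)
    show "card b = 3" using frame_card[OF F[OF L(1)] L(2,3)] .
    show "inj_on (\<lambda>p. l (fst p)) b"
    proof (rule inj_onI)
      fix p q assume pq: "p \<in> b" "q \<in> b" "l (fst p) = l (fst q)"
      have "fst p \<in> L" "fst q \<in> L" using bsub[OF L] pq(1,2) by auto
      then have "fst p = fst q" using ldiff[OF L(1)] pq(3) by blast
      then show "p = q" using frame_inj[OF F[OF L(1)] L(2,3)] pq by (auto dest: inj_onD)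
    qed
    fix p q assume p: "p \<in> b \<inter> X \<times> {..<g}" "q \<in> b \<inter> X \<times> {..<g}" "p \<noteq> q"
    have "p \<in> L \<times> {..<g}" "q \<in> L \<times> {..<g}" using p bsub[OF L] by auto
    then have "b \<subseteq> L \<times> {..<g}" using frame_sub[OF F[OF L(1)] L(2,3), of p q] p by auto
    then show "b \<subseteq> X \<times> {..<g}" using sub[OF L(1)] by auto
  next
    fix p q assume p: "p \<in> X \<times> {..<2*g}" "q \<in> X \<times> {..<2*g}" "l (fst p) \<noteq> l (fst q)"
    then obtain L where L: "L \<in> \<L>" "fst p \<in> L" "fst q \<in> L" using ex[of "fst p" "fst q"] by auto
    have "p \<in> L \<times> {..<2*g}" "q \<in> L \<times> {..<2*g}" "fst p \<noteq> fst q" using p L by (auto simp: mem_Times_iff)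
    then obtain k b where "k \<in> L \<times> {..<g}" "b \<in> F L k" "p \<in> b" "q \<in> b"
      using frame_ex[OF F[OF L(1)]] by blast
    then show "\<exists>k\<in>X \<times> {..<g}. \<exists>b\<in>H k. p \<in> b \<and> q \<in> b"
      using L sub[OF L(1)] by (intro bexI[of _ k] bexI[of _ b]) (auto simp: H_def)
  next
    fix k k' b b' p q
    assume kk: "k \<in> X \<times> {..<g}" "k' \<in> X \<times> {..<g}" "b \<in> H k" "b' \<in> H k'"
      and p: "p \<in> b \<inter> b'" "q \<in> b \<inter> b'" "p \<noteq> q"
    obtain L L' where L: "L \<in> \<L>" "k \<in> L \<times> {..<g}" "b \<in> F L k" "L' \<in> \<L>" "k' \<in> L' \<times> {..<g}" "b' \<in> F L' k'"
      using kk by (auto simp: H_def)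
    have "L = L'" using same[OF L(1,4,2,5,3,6), of p q] p by auto
    then show "k = k'" "b = b'"
      using frame_uniq[OF F[OF L(1)] L(2) _ L(3), of k' b' p q] L p by auto
  qed
  have fib: "card {p \<in> X \<times> {..<h}. l (fst p) = i} = t * h" if "i \<in> S" for i and h :: nat
  proof -
    have "{p \<in> X \<times> {..<h}. l (fst p) = i} = {x\<in>X. l x = i} \<times> {..<h}" by auto
    then show ?thesis by (simp add: card_cartesian_product l(2)[OF that])
  qed
  show ?thesis
    by (rule has_frameI[OF fr _ _ _ _ _ _ _ bij_betw_id])
      (use l(1) pos in \<open>auto simp: fib\<close>)
qed

lemma has_frame_pbd:
  assumes "\<And>L. L \<in> \<L> \<Longrightarrow> L \<subseteq> S" and "\<And>L. L \<in> \<L> \<Longrightarrow> has_frame g L"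
    and "\<And>x y. x \<in> S \<Longrightarrow> y \<in> S \<Longrightarrow> x \<noteq> y \<Longrightarrow> \<exists>L\<in>\<L>. x \<in> L \<and> y \<in> L"
    and "\<And>x y L L'. x \<noteq> y \<Longrightarrow> L \<in> \<L> \<Longrightarrow> L' \<in> \<L> \<Longrightarrow> x \<in> L \<Longrightarrow> y \<in> L \<Longrightarrow>
       x \<in> L' \<Longrightarrow> y \<in> L' \<Longrightarrow> L = L'"
    and "g > 0"
  shows "has_frame g S"
proof -
  have "has_frame (g * 1) S"
  proof (rule has_frame_gdd[where \<L> = \<L> and l = "\<lambda>x. x" and X = S])
    show "card {x\<in>S. x = i} = 1" if "i \<in> S" for i
    proof -
      have "{x\<in>S. x = i} = {i}" using that by auto
      then show ?thesis by simp
    qed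
  qed (use assms in auto)
  then show ?thesis by simp
qed

section \<open>Inflation\<close>

text \<open>A resolvable transversal design with three groups of size \<open>m\<close>: \<open>v r c i\<close> is the point that the
  \<open>i\<close>-th block of the \<open>c\<close>-th parallel class has in the \<open>r\<close>-th group.\<close>

definition rtd3 :: "nat \<Rightarrow> (nat \<Rightarrow> nat \<Rightarrow> nat \<Rightarrow> nat) \<Rightarrow> bool" where
  "rtd3 m v \<longleftrightarrow>
     (\<forall>r<3. \<forall>c<m. bij_betw (v r c) {..<m} {..<m}) \<and>
     (\<forall>r<3. \<forall>s<3. r \<noteq> s \<longrightarrow>
        bij_betw (\<lambda>(c, i). (v r c i, v s c i)) ({..<m} \<times> {..<m}) ({..<m} \<times> {..<m}))"

text \<open>Blocks are unordered, while \<open>rtd3\<close> numbers its groups; \<open>e b\<close>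
  supplies a numbering of the points of \<open>b\<close> by 0, 1, 2.\<close>

definition inflate_block ::
    "('p set \<Rightarrow> 'p \<Rightarrow> nat) \<Rightarrow> (nat \<Rightarrow> nat \<Rightarrow> nat \<Rightarrow> nat) \<Rightarrow> nat \<Rightarrow> 'p set \<Rightarrow> nat \<Rightarrow> ('p \<times> nat) set" where
  "inflate_block e v c b i = (\<lambda>p. (p, v (e b p) c i)) ` b"

text \<open>A transversal design is placed over each block \<open>b\<close>. Its \<open>c\<close>-th
  parallel class covers the points over \<open>b\<close> once, so that all \<open>b\<close> of class
  \<open>k\<close> together give the class \<open>(k, c)\<close>. Pairs over different points are
  settled by the transversal designs; pairs over one point lie in one group. Blocks inside
  \<open>W\<close> yield blocks inside \<open>W \<times> {..<m}\<close>.\<close>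

lemma frame_inflate:
  assumes fr: "frame Q W \<rho> K \<kappa> F" and v: "rtd3 m v"
    and e: "\<And>b. card b = 3 \<Longrightarrow> bij_betw (e b) b {..<3}"
  shows "frame (Q \<times> {..<m}) (W \<times> {..<m}) (\<rho> \<circ> fst) (K \<times> {..<m}) (\<kappa> \<circ> fst)
    (\<lambda>(k, c). \<Union>b\<in>F k. inflate_block e v c b ` {..<m})"
proof -
  have v1: "bij_betw (v r c) {..<m} {..<m}" if "r < 3" "c < m" for r c
    using v that unfolding rtd3_def by blast
  have v2: "bij_betw (\<lambda>(c, i). (v r c i, v s c i)) ({..<m} \<times> {..<m}) ({..<m} \<times> {..<m})"
    if "r < 3" "s < 3" "r \<noteq> s" for r s
    using v that unfolding rtd3_def by blast
  have e': "e b p < 3" "p \<in> b \<Longrightarrow> q \<in> b \<Longrightarrow> p \<noteq> q \<Longrightarrow> e b p \<noteq> e b q"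
    if "k \<in> K" "b \<in> F k" "p \<in> b" for k b p q
  proof -
    have "bij_betw (e b) b {..<3}" using e[OF frame_card[OF fr that(1,2)]] .
    then show "e b p < 3" "p \<in> b \<Longrightarrow> q \<in> b \<Longrightarrow> p \<noteq> q \<Longrightarrow> e b p \<noteq> e b q"
      using that(3) by (auto simp: bij_betw_def inj_on_eq_iff)
  qed
  have mem: "(p, x) \<in> inflate_block e v c b i \<longleftrightarrow> p \<in> b \<and> x = v (e b p) c i" for p x c b i
    by (auto simp: inflate_block_def)
  have inj: "inj_on (\<lambda>p. (p, v (e b p) c i)) A" for A b c i by (auto simp: inj_on_def)
  show ?thesis
    unfolding frame_def
  proof (intro conjI ballI impI)
    fix kc assume "kc \<in> K \<times> {..<m}"
    then obtain k c where kc: "kc = (k, c)" "k \<in> K" "c < m" by auto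
    note P = frame_partition[OF fr kc(2)]
    have "partition_on {p \<in> Q \<times> {..<m}. \<rho> (fst p) \<noteq> \<kappa> k} (\<Union>b\<in>F k. inflate_block e v c b ` {..<m})"
    proof (rule partition_onI)
      show "\<Union> (\<Union>b\<in>F k. inflate_block e v c b ` {..<m}) = {p \<in> Q \<times> {..<m}. \<rho> (fst p) \<noteq> \<kappa> k}"
      proof (intro equalityI subsetI)
        fix z assume "z \<in> \<Union> (\<Union>b\<in>F k. inflate_block e v c b ` {..<m})"
        then obtain p x b i where z: "z = (p, x)" "b \<in> F k" "i < m" "p \<in> b" "x = v (e b p) c i"
          by (cases z) (auto simp: mem)
        then have "x < m" using v1[OF e'(1)[OF kc(2) z(2,4)] kc(3)] by (auto simp: bij_betw_def)
        then show "z \<in> {p \<in> Q \<times> {..<m}. \<rho> (fst p) \<noteq> \<kappa> k}"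
          using frame_subset[OF fr kc(2) z(2)] z by auto
      next
        fix z assume z: "z \<in> {p \<in> Q \<times> {..<m}. \<rho> (fst p) \<noteq> \<kappa> k}"
        obtain p x where px: "z = (p, x)" by (cases z)
        then have "p \<in> \<Union> (F k)" using z partition_onD1[OF P] by auto
        then obtain b where b: "b \<in> F k" "p \<in> b" by auto
        have "x \<in> v (e b p) c ` {..<m}"
          using v1[OF e'(1)[OF kc(2) b] kc(3)] z px by (auto simp: bij_betw_def)
        then obtain i where "i < m" "x = v (e b p) c i" by auto
        then have "z \<in> inflate_block e v c b i" "i \<in> {..<m}" using b by (auto simp: px mem)
        then show "z \<in> \<Union> (\<Union>b\<in>F k. inflate_block e v c b ` {..<m})" using b(1) by blast
      qed
      show "{} \<notin> (\<Union>b\<in>F k. inflate_block e v c b ` {..<m})"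
        using partition_onD3[OF P] by (auto simp: inflate_block_def)
      fix A B assume "A \<in> (\<Union>b\<in>F k. inflate_block e v c b ` {..<m})"
        "B \<in> (\<Union>b\<in>F k. inflate_block e v c b ` {..<m})" "A \<noteq> B"
      then obtain b b' i i' where b: "b \<in> F k" "b' \<in> F k" "i < m" "i' < m"
        "A = inflate_block e v c b i" "B = inflate_block e v c b' i'" by blast
      show "disjnt A B" unfolding disjnt_iff
      proof (intro allI notI, elim conjE)
        fix z assume z: "z \<in> A" "z \<in> B"
        obtain p x where px: "z = (p, x)" by (cases z)
        have p: "p \<in> b" "p \<in> b'" "x = v (e b p) c i" "x = v (e b' p) c i'"
          using z by (simp_all add: b px mem)
        then have "b = b'" using partition_onD2[OF P] b(1,2) by (auto simp: disjoint_def)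
        moreover have "i = i'"
          using v1[OF e'(1)[OF kc(2) b(1) p(1)] kc(3)] p(3,4) b(3,4) \<open>b = b'\<close>
          by (auto simp: bij_betw_def inj_on_eq_iff)
        ultimately show False using \<open>A \<noteq> B\<close> b(5,6) by simp
      qed
    qed
    then show "partition_on {p \<in> Q \<times> {..<m}. (\<rho> \<circ> fst) p \<noteq> (\<kappa> \<circ> fst) kc}
        (case kc of (k, c) \<Rightarrow> \<Union>b\<in>F k. inflate_block e v c b ` {..<m})"
      by (simp add: kc)
  next
    fix kc B assume "kc \<in> K \<times> {..<m}" and B: "B \<in> (case kc of (k, c) \<Rightarrow> \<Union>b\<in>F k. inflate_block e v c b ` {..<m})"
    then obtain k c where kc: "kc = (k, c)" "k \<in> K" "c < m" by auto
    then obtain b i where b: "b \<in> F k" "i < m" "B = inflate_block e v c b i" using B by auto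
    show "card B = 3" using frame_card[OF fr kc(2) b(1)] by (simp add: b(3) inflate_block_def card_image[OF inj])
    show "inj_on (\<rho> \<circ> fst) B"
      using frame_inj[OF fr kc(2) b(1)] unfolding b(3) inflate_block_def
      by (intro comp_inj_on_iff[THEN iffD2] inj_onI) (auto simp: inj_on_eq_iff)
    fix z z' assume z: "z \<in> B \<inter> W \<times> {..<m}" "z' \<in> B \<inter> W \<times> {..<m}" "z \<noteq> z'"
    obtain p x p' x' where px: "z = (p, x)" "z' = (p', x')" by (cases z, cases z')
    have p: "p \<in> b" "p' \<in> b" "p \<in> W" "p' \<in> W" "p \<noteq> p'"
      using z by (auto simp: px b(3) mem)
    then have "b \<subseteq> W" using frame_sub[OF fr kc(2) b(1)] by blast
    moreover have "v (e b p) c i < m" if "p \<in> b" for p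
      using v1[OF e'(1)[OF kc(2) b(1) that] kc(3)] b(2) by (auto simp: bij_betw_def)
    ultimately show "B \<subseteq> W \<times> {..<m}" by (auto simp: b(3) inflate_block_def)
  next
    fix z z' assume z: "z \<in> Q \<times> {..<m}" "z' \<in> Q \<times> {..<m}" "(\<rho> \<circ> fst) z \<noteq> (\<rho> \<circ> fst) z'"
    obtain p x q y where px: "z = (p, x)" "z' = (q, y)" by (cases z, cases z')
    obtain k b where b: "k \<in> K" "b \<in> F k" "p \<in> b" "q \<in> b"
      using frame_ex[OF fr, of p q] z px by auto
    have "p \<noteq> q" using z px by auto
    have "(x, y) \<in> (\<lambda>(c, i). (v (e b p) c i, v (e b q) c i)) ` ({..<m} \<times> {..<m})"
      using v2[OF e'(1)[OF b(1,2,3)] e'(1)[OF b(1,2,4)] e'(2)[OF b(1,2,3,3,4) \<open>p \<noteq> q\<close>]] z px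
      by (auto simp: bij_betw_def)
    then obtain c i where ci: "c < m" "i < m" "x = v (e b p) c i" "y = v (e b q) c i" by auto
    have "z \<in> inflate_block e v c b i" "z' \<in> inflate_block e v c b i"
      using b ci by (simp_all add: px mem)
    then show "\<exists>k\<in>K \<times> {..<m}. \<exists>B\<in>(case k of (k, c) \<Rightarrow> \<Union>b\<in>F k. inflate_block e v c b ` {..<m}).
        z \<in> B \<and> z' \<in> B"
      using b(1,2) ci(1,2) by (intro bexI[of _ "(k, c)"] bexI[of _ "inflate_block e v c b i"]) auto
  next
    fix kc kc' B B' z z'
    assume kcs: "kc \<in> K \<times> {..<m}" "kc' \<in> K \<times> {..<m}"
      and Bs: "B \<in> (case kc of (k, c) \<Rightarrow> \<Union>b\<in>F k. inflate_block e v c b ` {..<m})"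
        "B' \<in> (case kc' of (k, c) \<Rightarrow> \<Union>b\<in>F k. inflate_block e v c b ` {..<m})"
      and z: "z \<in> B \<inter> B'" "z' \<in> B \<inter> B'" "z \<noteq> z'"
    obtain k c where kc: "kc = (k, c)" "k \<in> K" "c < m" using kcs by auto
    obtain k' c' where kc': "kc' = (k', c')" "k' \<in> K" "c' < m" using kcs by auto
    obtain b i where b: "b \<in> F k" "i < m" "B = inflate_block e v c b i" using Bs kc by auto
    obtain b' i' where b': "b' \<in> F k'" "i' < m" "B' = inflate_block e v c' b' i'" using Bs kc' by auto
    obtain p x q y where px: "z = (p, x)" "z' = (q, y)" by (cases z, cases z')
    have m: "p \<in> b" "x = v (e b p) c i" "q \<in> b" "y = v (e b q) c i"
      "p \<in> b'" "x = v (e b' p) c' i'" "q \<in> b'" "y = v (e b' q) c' i'"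
      using z by (simp_all add: px b(3) b'(3) mem)
    have "p \<noteq> q" using z(3) m(2,4) px by auto
    then have eq: "k = k'" "b = b'"
      using frame_uniq[OF fr kc(2) kc'(2) b(1) b'(1) m(1,5,3,7)] by auto
    note bij = v2[OF e'(1)[OF kc(2) b(1) m(1)] e'(1)[OF kc(2) b(1) m(3)]
        e'(2)[OF kc(2) b(1) m(1,1,3) \<open>p \<noteq> q\<close>]]
    have "(c, i) = (c', i')"
      by (rule inj_onD[OF bij_betw_imp_inj_on[OF bij]])
        (use m eq kc kc' b b' in auto)
    then show "kc = kc'" "B = B'" using kc kc' b b' eq by auto
  qed
qed

lemma has_frame_inflate:
  assumes "has_frame g S" "rtd3 m v" "g > 0" "m > 0"
  shows "has_frame (g * m) S"
proof -
  obtain F where F: "frame (S \<times> {..<2 * g}) (S \<times> {..<g}) fst (S \<times> {..<g}) fst F"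
    using assms(1) unfolding has_frame_def by blast
  have "\<exists>f. bij_betw f b {..<3::nat}" if "card b = 3" for b :: "('a \<times> nat) set"
    using ex_bij_betw_finite_nat[of b] that by (metis atLeast0LessThan card.infinite zero_neq_numeral)
  then obtain e :: "('a \<times> nat) set \<Rightarrow> 'a \<times> nat \<Rightarrow> nat"
    where e: "\<And>b. card b = 3 \<Longrightarrow> bij_betw (e b) b {..<3}" by metis
  have fib: "card {p \<in> (S \<times> {..<h}) \<times> {..<m}. fst (fst p) = i} = h * m" if "i \<in> S" for h i
  proof -
    have "{p \<in> (S \<times> {..<h}) \<times> {..<m}. fst (fst p) = i} = ({i} \<times> {..<h}) \<times> {..<m}" using that by auto
    then show ?thesis by (simp add: card_cartesian_product)
  qed
  show ?thesis
    by (rule has_frameI[OF frame_inflate[OF F assms(2) e] _ _ _ _ _ _ _ bij_betw_id])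
      (use assms(3,4) fib[of _ "2 * g"] fib[of _ g] in auto)
qed

text \<open>Meant for a field with \<open>m\<close> elements: \<open>add\<close> is its addition
  table and \<open>l\<close> is multiplication by an element w other than 0 and 1. Block
  \<open>i\<close> of class \<open>c\<close> then consists of i, i + c and i + w c. For
  \<open>m = 4\<close> the addition is bitwise XOR; in both instances below w is written 2.\<close>

definition rtd_entry :: "nat list list \<Rightarrow> nat list \<Rightarrow> nat \<Rightarrow> nat \<Rightarrow> nat \<Rightarrow> nat" where
  "rtd_entry add l r c i = add ! i ! (if r = 0 then 0 else if r = 1 then c else l ! c)"

text \<open>Injectivity suffices, because the maps send a finite set into itself; exchanging the two
  components reduces to \<open>r < s\<close>.\<close>

lemma rtd3I:
  assumes "\<And>r c i. r < 3 \<Longrightarrow> c < m \<Longrightarrow> i < m \<Longrightarrow> v r c i < m"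
    and "\<And>r c i j. r < 3 \<Longrightarrow> c < m \<Longrightarrow> i < m \<Longrightarrow> j < m \<Longrightarrow> v r c i = v r c j \<Longrightarrow> i = j"
    and "\<And>r s c i d j. r < s \<Longrightarrow> s < 3 \<Longrightarrow> c < m \<Longrightarrow> i < m \<Longrightarrow> d < m \<Longrightarrow> j < m \<Longrightarrow>
      v r c i = v r d j \<Longrightarrow> v s c i = v s d j \<Longrightarrow> c = d \<and> i = j"
  shows "rtd3 m v"
  unfolding rtd3_def
proof (intro conjI allI impI)
  fix r c :: nat assume "r < 3" "c < m"
  then show "bij_betw (v r c) {..<m} {..<m}"
    unfolding bij_betw_def
    by (intro conjI endo_inj_surj inj_onI) (auto intro: assms(1) dest: assms(2))
next
  fix r s :: nat assume rs: "r < 3" "s < 3" "r \<noteq> s"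
  let ?f = "\<lambda>(c, i). (v r c i, v s c i)"
  have inj: "inj_on ?f ({..<m} \<times> {..<m})"
    using assms(3)[of r s] assms(3)[of s r] rs by (cases "r < s") (auto simp: inj_on_def)
  show "bij_betw ?f ({..<m} \<times> {..<m}) ({..<m} \<times> {..<m})"
    unfolding bij_betw_def
    by (intro conjI endo_inj_surj inj) (use assms(1) rs in auto)
qed

definition rtd_check :: "nat \<Rightarrow> (nat \<Rightarrow> nat \<Rightarrow> nat \<Rightarrow> nat) \<Rightarrow> bool" where
  "rtd_check m v \<longleftrightarrow>
     list_all (\<lambda>r. list_all (\<lambda>c. distinct (map (v r c) [0..<m]) \<and>
       list_all (\<lambda>i. v r c i < m) [0..<m]) [0..<m]) [0..<3] \<and>
     list_all (\<lambda>(r, s). distinct (map (\<lambda>(c, i). (v r c i, v s c i)) (List.product [0..<m] [0..<m])))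
       [(0, 1), (0, 2), (1, 2)]"

lemma rtd_check:
  assumes "rtd_check m v"
  shows "rtd3 m v"
proof (rule rtd3I)
  show "v r c i < m" if "r < 3" "c < m" "i < m" for r c i
    using assms that by (simp add: rtd_check_def list_all_iff)
  show "i = j" if "r < 3" "c < m" "i < m" "j < m" "v r c i = v r c j" for r c i j
  proof -
    have "distinct (map (v r c) [0..<m])"
      using assms that(1,2) unfolding rtd_check_def list_all_iff by simp
    then have "inj_on (v r c) {..<m}" by (simp add: distinct_map atLeast0LessThan)
    then show ?thesis by (rule inj_onD) (use that in auto)
  qed
  fix r s c i d j :: nat
  assume *: "r < s" "s < 3" "c < m" "i < m" "d < m" "j < m" "v r c i = v r d j" "v s c i = v s d j"
  let ?f = "\<lambda>(c, i). (v r c i, v s c i)"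
  have "(r, s) \<in> set [(0, 1), (0, 2), (1, 2)]" using *(1,2) by auto
  then have "distinct (map ?f (List.product [0..<m] [0..<m]))"
    using assms unfolding rtd_check_def list_all_iff by fast
  then have "inj_on ?f ({..<m} \<times> {..<m})" by (simp add: distinct_map atLeast0LessThan)
  then have "(c, i) = (d, j)" by (rule inj_onD) (use * in auto)
  then show "c = d \<and> i = j" by simp
qed

lemma rtd3_3: "rtd3 3 (rtd_entry [[0,1,2],[1,2,0],[2,0,1]] [0,2,1])"
  by (rule rtd_check) code_simp

lemma rtd3_4: "rtd3 4 (rtd_entry [[0,1,2,3],[1,0,3,2],[2,3,0,1],[3,2,1,0]] [0,2,3,1])"
  by (rule rtd_check) code_simp

section \<open>Truncated transversal designs\<close>

definition admissible :: "nat \<Rightarrow> bool" where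
  "admissible n \<longleftrightarrow> has_frame 12 {..<n}"

lemma admissible_has_frame: "admissible (card S) \<Longrightarrow> finite S \<Longrightarrow> has_frame 12 S"
  using ex_bij_betw_nat_finite[of S] has_frame_bij[of 12 "{..<card S}" _ S]
  by (auto simp: admissible_def atLeast0LessThan)

lemma has_frame_admissible: "has_frame 12 S \<Longrightarrow> finite S \<Longrightarrow> admissible (card S)"
  using ex_bij_betw_finite_nat[of S] has_frame_bij[of 12 S _ "{..<card S}"]
  by (auto simp: admissible_def atLeast0LessThan)

lemma admissible_0: "admissible 0" and admissible_1: "admissible (Suc 0)"
  unfolding admissible_def by (rule has_frame_trivial; simp)+

lemma admissible_pbd:
  assumes "finite S" and sub: "\<And>L. L \<in> \<L> \<Longrightarrow> L \<subseteq> S" and admissible: "\<And>L. L \<in> \<L> \<Longrightarrow> admissible (card L)"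
    and ex: "\<And>x y. x \<in> S \<Longrightarrow> y \<in> S \<Longrightarrow> x \<noteq> y \<Longrightarrow> \<exists>L\<in>\<L>. x \<in> L \<and> y \<in> L"
    and uniq: "\<And>x y L L'. x \<noteq> y \<Longrightarrow> L \<in> \<L> \<Longrightarrow> L' \<in> \<L> \<Longrightarrow> x \<in> L \<Longrightarrow> y \<in> L \<Longrightarrow>
       x \<in> L' \<Longrightarrow> y \<in> L' \<Longrightarrow> L = L'"
  shows "admissible (card S)"
proof (rule has_frame_admissible)
  have "has_frame 12 L" if "L \<in> \<L>" for L
    using admissible_has_frame[OF admissible[OF that] finite_subset[OF sub[OF that] assms(1)]] .
  from has_frame_pbd[OF sub this ex uniq] show "has_frame 12 S" by simp
qed (rule assms(1))

lemma mod_eq_imp_eq: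
  fixes a b m :: nat
  assumes "a < m" "b < m" "int m dvd int a - int b"
  shows "a = b"
proof -
  have "int a mod int m = int b mod int m" using assms(3) by (simp add: mod_eq_dvd_iff)
  then show ?thesis using assms(1,2) by simp
qed

text \<open>The line of slope \<open>a\<close> and intercept \<open>b\<close> at abscissa
  \<open>j\<close>. Column \<open>l\<close> records the slope, so parallel lines meet there.\<close>

definition td_coord :: "nat \<Rightarrow> nat \<Rightarrow> nat \<Rightarrow> nat \<Rightarrow> nat \<Rightarrow> nat" where
  "td_coord l m a b j = (if j < l then (a * j + b) mod m else a)"

lemma td_coord_less: "a < m \<Longrightarrow> td_coord l m a b j < m"
  by (auto simp: td_coord_def)

text \<open>Subtracting the congruences in two ordinary columns leaves
  \<open>(a - a') * (j' - j)\<close> divisible by \<open>m\<close>, and \<open>j' - j\<close>, lying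
  strictly between 0 and \<open>l\<close>, cancels by coprimality. If \<open>j'\<close> is the slope
  column, \<open>a = a'\<close> is immediate.\<close>

lemma td_coord_inj:
  assumes cop: "\<And>d. 0 < d \<Longrightarrow> d < l \<Longrightarrow> coprime d m"
    and j: "j \<noteq> j'" "j \<le> l" "j' \<le> l"
    and less: "a < m" "b < m" "a' < m" "b' < m"
    and eq: "td_coord l m a b j = td_coord l m a' b' j" "td_coord l m a b j' = td_coord l m a' b' j'"
  shows "a = a' \<and> b = b'"
  using j eq
proof (induction j j' rule: linorder_wlog)
  case (sym j j')
  then show ?case by auto
next
  case (le j j')
  then have lt: "j < j'" "j < l" by auto
  have dj: "int m dvd (int a * int i + int b) - (int a' * int i + int b')"
    if "td_coord l m a b i = td_coord l m a' b' i" "i < l" for i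
  proof -
    have "int ((a * i + b) mod m) = int ((a' * i + b') mod m)" using that by (simp add: td_coord_def)
    then show ?thesis by (simp add: zmod_int mod_eq_dvd_iff)
  qed
  note 1 = dj[OF le(5) lt(2)]
  have "a = a'"
  proof (cases "j' < l")
    case True
    from dj[OF le(6) True] 1 have "int m dvd ((int a * int j' + int b) - (int a' * int j' + int b')) -
        ((int a * int j + int b) - (int a' * int j + int b'))" by (rule dvd_diff)
    also have "\<dots> = (int a - int a') * int (j' - j)"
      using lt(1) by (simp add: of_nat_diff algebra_simps)
    finally have "int m dvd (int a - int a') * int (j' - j)" .
    moreover have "coprime (int (j' - j)) (int m)"
      unfolding coprime_int_iff by (rule cop) (use lt True in auto)
    ultimately have "int m dvd int a - int a'"
      by (simp add: coprime_commute coprime_dvd_mult_left_iff)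
    then show ?thesis using less by (intro mod_eq_imp_eq)
  next
    case False
    then show ?thesis using le(6) by (simp add: td_coord_def)
  qed
  moreover have "b = b'"
    using 1 less by (intro mod_eq_imp_eq[of _ m]) (simp_all add: \<open>a = a'\<close>)
  ultimately show ?case by simp
qed

text \<open>By counting: the \<open>m * m\<close> lines give distinct pairs of values in the two
  columns, and there are only \<open>m * m\<close> pairs.\<close>

lemma td_coord_surj:
  assumes cop: "\<And>d. 0 < d \<Longrightarrow> d < l \<Longrightarrow> coprime d m"
    and j: "j \<noteq> j'" "j \<le> l" "j' \<le> l" and y: "y < m" "y' < m"
  shows "\<exists>a<m. \<exists>b<m. td_coord l m a b j = y \<and> td_coord l m a b j' = y'"
proof -
  let ?f = "\<lambda>(a, b). (td_coord l m a b j, td_coord l m a b j')"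
  have "?f ` ({..<m} \<times> {..<m}) = {..<m} \<times> {..<m}"
  proof (rule endo_inj_surj)
    show "inj_on ?f ({..<m} \<times> {..<m})"
      using td_coord_inj[OF cop j] by (auto simp: inj_on_def)
  qed (auto simp: td_coord_less)
  then have "(y, y') \<in> ?f ` ({..<m} \<times> {..<m})" using y by simp
  then show ?thesis by auto
qed

text \<open>The column \<open>Suc l\<close> consists of the point at infinity that is adjoined to every group.\<close>

lemma admissible_td:
  assumes m: "m > 0" and l: "4 \<le> l" and cop: "\<And>d. 0 < d \<Longrightarrow> d < l \<Longrightarrow> coprime d m"
    and sz: "\<And>j. j \<le> l \<Longrightarrow> sz j \<le> m" "\<And>j. j < 4 \<Longrightarrow> sz j = m" and e: "e \<le> 1"
    and groups: "\<And>j. j \<le> l \<Longrightarrow> admissible (sz j + e)"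
    and lines: "\<And>q. 4 \<le> q \<Longrightarrow> q \<le> Suc l \<Longrightarrow> admissible q"
  shows "admissible ((\<Sum>j\<le>l. sz j) + e)"
proof -
  define S where "S = (SIGMA j:{..Suc l}. {..<if j \<le> l then sz j else e})"
  define line where "line a b = {(j, td_coord l m a b j) | j. j \<le> l}" for a b
  define grp where "grp j = ({(j', y) | j' y. j' = j \<or> j' = Suc l} :: (nat \<times> nat) set)" for j
  define \<L> where "\<L> = {line a b \<inter> S | a b. a < m \<and> b < m} \<union> {grp j \<inter> S | j. j \<le> l}"
  have finS: "finite S" by (simp add: S_def)
  have cS: "card S = (\<Sum>j\<le>l. sz j) + e"
    by (simp add: S_def card_SigmaI atMost_Suc)
  have "admissible (card S)"
  proof (rule admissible_pbd[OF finS])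
    fix L assume "L \<in> \<L>"
    then consider a b where "L = line a b \<inter> S" "a < m" "b < m" | j where "L = grp j \<inter> S" "j \<le> l"
      by (auto simp: \<L>_def)
    then show "admissible (card L)"
    proof cases
      case (1 a b)
      have line: "line a b = (\<lambda>j. (j, td_coord l m a b j)) ` {..l}" by (auto simp: line_def)
      \<comment> \<open>Columns 0 to 3 are never truncated, so every line keeps at least four
        points.\<close>
      have "(\<lambda>j. (j, td_coord l m a b j)) ` {..<4} \<subseteq> L"
        using l sz(2) 1 by (auto simp: line_def S_def td_coord_less)
      from card_mono[OF _ this] have "4 \<le> card L"
        using finS 1(1) by (simp add: card_image inj_on_def)
      moreover have "card L \<le> card (line a b)" using 1(1) line by (intro card_mono) auto
      then have "card L \<le> Suc l" by (simp add: line card_image inj_on_def)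
      ultimately show ?thesis by (rule lines)
    next
      case (2 j)
      have "L = {j} \<times> {..<sz j} \<union> {Suc l} \<times> {..<e}"
        using 2 by (auto simp: grp_def S_def split: if_splits)
      moreover have "card ({j} \<times> {..<sz j} \<union> {Suc l} \<times> {..<e}) = sz j + e"
        using 2 by (subst card_Un_disjoint) auto
      ultimately show ?thesis using groups[OF 2(2)] by simp
    qed
  next
    fix x y assume xy: "x \<in> S" "y \<in> S" "x \<noteq> y"
    obtain j u j' u' where x: "x = (j, u)" "y = (j', u')" by (cases x, cases y)
    have lt: "u < m" if "(j, u) \<in> S" "j \<le> l" for j u
      using that sz(1)[OF that(2)] by (simp add: S_def)
    show "\<exists>L\<in>\<L>. x \<in> L \<and> y \<in> L"
    proof (cases "j \<le> l \<and> j' \<le> l \<and> j \<noteq> j'")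
      case True
      have u: "u < m" "u' < m" using lt xy True by (simp_all add: x)
      have "\<exists>a<m. \<exists>b<m. td_coord l m a b j = u \<and> td_coord l m a b j' = u'"
        by (rule td_coord_surj[OF cop]) (use True u in simp_all)
      then obtain a b where "a < m" "b < m" "td_coord l m a b j = u" "td_coord l m a b j' = u'"
        by blast
      then have "line a b \<inter> S \<in> \<L>" "x \<in> line a b \<inter> S" "y \<in> line a b \<inter> S"
        using xy x True by (auto simp: \<L>_def line_def)
      then show ?thesis by (intro bexI[of _ "line a b \<inter> S"] conjI)
    next
      case False
      have *: "j \<le> Suc l" "j' \<le> Suc l" "j = Suc l \<Longrightarrow> u < 1" "j' = Suc l \<Longrightarrow> u' < 1"
        using xy x e by (auto simp: S_def)
      \<comment> \<open>The point at infinity has the largest column, \<open>Suc l\<close>, so the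
        minimum is the index of a genuine group.\<close>
      define i where "i = min j j'"
      have "\<not> (j = Suc l \<and> j' = Suc l)" using *(3,4) xy(3) x by auto
      then have "i \<le> l \<and> (j = i \<or> j = Suc l) \<and> (j' = i \<or> j' = Suc l)"
        using *(1,2) False unfolding i_def min_def by presburger
      then have "grp i \<inter> S \<in> \<L>" "x \<in> grp i \<inter> S" "y \<in> grp i \<inter> S"
        using xy x by (auto simp: \<L>_def grp_def)
      then show ?thesis by (intro bexI[of _ "grp i \<inter> S"] conjI)
    qed
  next
    fix x y L L' assume xy: "x \<noteq> y" and L: "L \<in> \<L>" "L' \<in> \<L>" "x \<in> L" "y \<in> L" "x \<in> L'" "y \<in> L'"
    obtain j u j' u' where x: "x = (j, u)" "y = (j', u')" by (cases x, cases y)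
    have line: "j \<le> l \<and> j' \<le> l \<and> j \<noteq> j' \<and> u = td_coord l m a b j \<and> u' = td_coord l m a b j'"
      if "x \<in> line a b" "y \<in> line a b" for a b
    proof -
      have *: "j \<le> l" "j' \<le> l" "u = td_coord l m a b j" "u' = td_coord l m a b j'"
        using that unfolding x line_def by simp_all
      then show ?thesis using xy unfolding x by auto
    qed
    \<comment> \<open>The second part contradicts \<open>line\<close>, so a line and a group never
      share two points.\<close>
    have grp: "i = (if j = Suc l then j' else j) \<and> \<not> (j \<le> l \<and> j' \<le> l \<and> j \<noteq> j')"
      if "x \<in> grp i \<inter> S" "y \<in> grp i \<inter> S" "i \<le> l" for i
    proof -
      have *: "j = i \<or> j = Suc l" "j' = i \<or> j' = Suc l" using that by (simp_all add: x grp_def)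
      have "j = Suc l \<Longrightarrow> u < 1" "j' = Suc l \<Longrightarrow> u' < 1" using that e by (auto simp: x S_def)
      then have "\<not> (j = Suc l \<and> j' = Suc l)" using xy x by auto
      then show ?thesis using * that(3) by auto
    qed
    from L consider
      (ll) a b a' b' where "L = line a b \<inter> S" "L' = line a' b' \<inter> S" "a < m" "b < m" "a' < m" "b' < m"
    | (lg) a b i where "L = line a b \<inter> S" "L' = grp i \<inter> S" "i \<le> l"
    | (gl) a b i where "L' = line a b \<inter> S" "L = grp i \<inter> S" "i \<le> l"
    | (gg) i i' where "L = grp i \<inter> S" "L' = grp i' \<inter> S" "i \<le> l" "i' \<le> l"
      unfolding \<L>_def by blast
    then show "L = L'"
    proof cases
      case ll
      have p: "x \<in> line a b" "y \<in> line a b" "x \<in> line a' b'" "y \<in> line a' b'" using L ll by auto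
      have "a = a' \<and> b = b'"
        using line[OF p(1,2)] line[OF p(3,4)]
        by (intro td_coord_inj[OF cop _ _ _ ll(3-6), of l j j']) auto
      then show ?thesis using ll by simp
    next
      case lg
      then show ?thesis using line[of a b] grp[of i] L by auto
    next
      case gl
      then show ?thesis using line[of a b] grp[of i] L by auto
    next
      case gg
      then show ?thesis using grp[of i] grp[of i'] L by auto
    qed
  qed (auto simp: \<L>_def)
  then show ?thesis by (simp add: cS)
qed

text \<open>With \<open>l = 5\<close> the differences of ordinary columns are 1 to 4, for which
  coprimality of \<open>m\<close> to 6 suffices. Four groups stay full and two are cut to
  \<open>a\<close> and \<open>b\<close>, which leaves lines of 4, 5 or 6 points. The choice
  \<open>e = 1\<close> enlarges every group by the point at infinity; in the table below it is what
  gives 27, 31 and 43.\<close>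

lemma admissible_td6:
  assumes m: "odd m" "\<not> 3 dvd m" and "a \<le> m" "b \<le> m" "e \<le> 1"
    and "admissible (m + e)" "admissible (a + e)" "admissible (b + e)" and "admissible 4" "admissible 5" "admissible 6"
  shows "admissible (4 * m + a + b + e)"
proof -
  define sz where "sz = (\<lambda>j::nat. if j < 4 then m else if j = 4 then a else b)"
  have "admissible ((\<Sum>j\<le>5. sz j) + e)"
  proof (rule admissible_td[where m = m])
    show "m > 0" using m by (auto intro: Nat.gr0I)
    show "coprime d m" if "0 < d" "d < 5" for d
    proof -
      have "coprime 2 m" using m(1) by simp
      moreover from this have "coprime (2 * 2) m" by (simp only: coprime_mult_left_iff)
      moreover have "coprime 3 m" using m(2) by (intro prime_imp_coprime) simp_all
      moreover have "d = 1 \<or> d = 2 \<or> d = 3 \<or> d = 4" using that by auto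
      ultimately show ?thesis by (elim disjE) simp_all
    qed
    show "admissible q" if "4 \<le> q" "q \<le> Suc 5" for q
    proof -
      have "q = 4 \<or> q = 5 \<or> q = 6" using that by auto
      then show ?thesis using assms by auto
    qed
  qed (use assms in \<open>auto simp: sz_def\<close>)
  moreover have "(\<Sum>j\<le>5. sz j) = 4 * m + a + b"
  proof -
    have "{..5} = {0, 1, 2, 3, 4, 5::nat}" by auto
    then show ?thesis by (simp add: sz_def)
  qed
  ultimately show ?thesis by simp
qed

section \<open>Cyclic starters\<close>

definition triple_set :: "'a \<times> 'a \<times> 'a \<Rightarrow> 'a set" where
  "triple_set = (\<lambda>(a, b, c). {a, b, c})"

definition triple_points :: "('a \<times> 'a \<times> 'a) list \<Rightarrow> 'a list" where
  "triple_points ts = concat (map (\<lambda>(a, b, c). [a, b, c]) ts)"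

definition triple_pairs :: "('a \<times> 'a \<times> 'a) list \<Rightarrow> ('a \<times> 'a) list" where
  "triple_pairs ts = concat (map (\<lambda>(a, b, c). [(a, b), (b, a), (a, c), (c, a), (b, c), (c, b)]) ts)"

text \<open>Packs the difference modulo \<open>N\<close> and the two copies, read as binary digits,
  into one number below \<open>4 * N\<close>, so that a single sorted list checks all pure and mixed
  differences.\<close>

definition diff_code :: "int \<Rightarrow> int \<times> int \<Rightarrow> int" where
  "diff_code N = (\<lambda>(u, v). (v - u) mod N + N * (2 * (u div N) + v div N))"

text \<open>The integers \<open>0, \<dots>, 2 * N - 1\<close> represent two copies of the cyclic group of order \<open>N\<close>, the lower one
  being the subdesign; the groups of the design are the residue classes modulo \<open>n\<close>. A starter is a
  partial parallel class missing the residue class of 0 in which, for any two copies, every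
  difference outside that class occurs exactly once.\<close>

definition starter :: "int \<Rightarrow> int \<Rightarrow> (int \<times> int \<times> int) list \<Rightarrow> bool" where
  "starter n N ts \<longleftrightarrow>
     sort (triple_points ts) = filter (\<lambda>z. z mod n \<noteq> 0) [0..2 * N - 1] \<and>
     sort (map (diff_code N) (triple_pairs ts)) = filter (\<lambda>z. z mod n \<noteq> 0) [0..4 * N - 1] \<and>
     list_all (\<lambda>(a, b, c). (a < N \<and> b < N \<longrightarrow> c < N) \<and> (a < N \<and> c < N \<longrightarrow> b < N) \<and>
       (b < N \<and> c < N \<longrightarrow> a < N)) ts"

text \<open>Sorting keeps multiplicities, so one computable equation with a duplicate-free list
  expresses both "at least once" and "at most once". Starters, GDDs and explicit frames are all
  checked in this form.\<close>

lemma sort_eq_filter_upto: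
  assumes "sort xs = filter P [a..b]"
  shows "distinct xs" and "set xs = {z\<in>{a..b}. P z}"
proof -
  have "distinct (sort xs)" unfolding assms by simp
  then show "distinct xs" by simp
  have "set (sort xs) = {z\<in>{a..b}. P z}" unfolding assms by auto
  then show "set xs = {z\<in>{a..b}. P z}" by simp
qed

text \<open>Translation by \<open>k\<close> within the copy \<open>p div N\<close>: the cyclic group
  acts on both copies at once.\<close>

definition shift :: "int \<Rightarrow> int \<Rightarrow> int \<Rightarrow> int" where
  "shift N k p = N * (p div N) + (p + k) mod N"

lemma shift_div: "N > 0 \<Longrightarrow> shift N k p div N = p div N"
  and shift_mod: "N > 0 \<Longrightarrow> shift N k p mod N = (p + k) mod N"
  by (simp_all add: shift_def)

lemma shift_range: "N > 0 \<Longrightarrow> shift N k p \<in> {0..<2 * N} \<longleftrightarrow> p \<in> {0..<2 * N}"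
proof -
  assume N: "N > 0"
  have "q \<in> {0..<2 * N} \<longleftrightarrow> 0 \<le> q div N \<and> q div N < 2" for q
  proof -
    have "q div N < 2 \<longleftrightarrow> q < 2 * N"
      using pos_imp_zdiv_neg_iff[OF N, of "q - 2 * N"] div_mult_self1[of N q "- 2"] N by simp
    then show ?thesis using N by (auto simp: pos_imp_zdiv_nonneg_iff)
  qed
  then show ?thesis using shift_div[OF N] by simp
qed

lemma shift_neg: "N > 0 \<Longrightarrow> shift N k (shift N (- k) p) = p"
proof -
  assume N: "N > 0"
  have "shift N k (shift N (- k) p) = N * (p div N) + (shift N (- k) p + k) mod N"
    unfolding shift_def[of N k] shift_div[OF N] ..
  also have "(shift N (- k) p + k) mod N = (shift N (- k) p mod N + k) mod N" by (simp add: mod_simps)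
  also have "\<dots> = p mod N" by (simp add: shift_mod[OF N] mod_simps)
  finally show ?thesis by simp
qed

lemma inj_shift: "N > 0 \<Longrightarrow> inj (shift N k)"
  using shift_neg[of N "- k"] by (metis injI minus_minus)

lemma mult_add_mod_dvd:
  fixes n N :: int
  assumes "n dvd N"
  shows "(N * a + b mod N) mod n = b mod n"
proof -
  have "N * a mod n = 0" using assms by simp
  then have "(N * a + b mod N) mod n = (0 + b mod N mod n) mod n"
    by (metis mod_add_eq mod_mod_trivial)
  then show ?thesis using assms by (simp add: mod_mod_cancel)
qed

lemma shift_mod_dvd: "n dvd N \<Longrightarrow> shift N k p mod n = (p + k) mod n"
  unfolding shift_def by (rule mult_add_mod_dvd)

lemma div_eq_0_or_1:
  fixes N q :: int
  assumes "N > 0" "q \<in> {0..<2 * N}"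
  shows "q div N = 0 \<or> q div N = 1"
proof (cases "q < N")
  case True
  then show ?thesis using assms by simp
next
  case False
  then have "(q - N) div N = 0" using assms by (intro div_pos_pos_trivial) auto
  then show ?thesis using \<open>N > 0\<close> div_mult_self1[of N q "- 1"] by simp
qed

lemma diff_code_eq_iff:
  assumes "N > 0" "u \<in> {0..<2 * N}" "v \<in> {0..<2 * N}" "u' \<in> {0..<2 * N}" "v' \<in> {0..<2 * N}"
  shows "diff_code N (u, v) = diff_code N (u', v') \<longleftrightarrow>
    (v - u) mod N = (v' - u') mod N \<and> u div N = u' div N \<and> v div N = v' div N"
proof -
  note div = div_eq_0_or_1[OF assms(1)]
  have "diff_code N (u, v) mod N = (v - u) mod N" "diff_code N (u, v) div N = 2 * (u div N) + v div N"
    "diff_code N (u', v') mod N = (v' - u') mod N" "diff_code N (u', v') div N = 2 * (u' div N) + v' div N"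
    using assms(1) by (simp_all add: diff_code_def)
  then have "diff_code N (u, v) = diff_code N (u', v') \<longleftrightarrow>
      (v - u) mod N = (v' - u') mod N \<and> 2 * (u div N) + v div N = 2 * (u' div N) + v' div N"
    by (metis div_mult_mod_eq)
  moreover have "2 * (u div N) + v div N = 2 * (u' div N) + v' div N \<longleftrightarrow>
      u div N = u' div N \<and> v div N = v' div N"
    using div[OF assms(2)] div[OF assms(3)] div[OF assms(4)] div[OF assms(5)] by linarith
  ultimately show ?thesis by simp
qed

lemma diff_code_range:
  assumes "N > 0" "u \<in> {0..<2 * N}" "v \<in> {0..<2 * N}"
  shows "diff_code N (u, v) \<in> {0..<4 * N}"
proof -
  note div = div_eq_0_or_1[OF assms(1)]
  have "r + N * (2 * a + b) \<in> {0..<4 * N}"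
    if "0 \<le> r" "r < N" "a = 0 \<or> a = 1" "b = 0 \<or> b = 1" for r a b
    using that by auto
  then show ?thesis
    using div[OF assms(2)] div[OF assms(3)] assms(1) by (simp add: diff_code_def)
qed

lemma diff_code_mod: "n dvd N \<Longrightarrow> diff_code N (u, v) mod n = (v - u) mod n"
  unfolding diff_code_def prod.case by (subst add.commute) (rule mult_add_mod_dvd)

lemma diff_code_shift: "N > 0 \<Longrightarrow> diff_code N (shift N k u, shift N k v) = diff_code N (u, v)"
proof -
  assume N: "N > 0"
  have "(shift N k v - shift N k u) mod N = (shift N k v mod N - shift N k u mod N) mod N"
    by (simp add: mod_simps)
  also have "\<dots> = (v - u) mod N" by (simp add: shift_mod[OF N] mod_simps)
  finally show ?thesis using N by (simp add: diff_code_def shift_div)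
qed

lemma set_triple_points: "set (triple_points ts) = (\<Union>t\<in>set ts. triple_set t)"
  by (auto simp: triple_points_def triple_set_def split: prod.splits)

lemma distinct_triple_points:
  assumes "distinct (triple_points ts)"
  shows "t \<in> set ts \<Longrightarrow> card (triple_set t) = 3"
    and "s \<in> set ts \<Longrightarrow> t \<in> set ts \<Longrightarrow> triple_set s \<noteq> triple_set t \<Longrightarrow> triple_set s \<inter> triple_set t = {}"
proof -
  define l where "l = (\<lambda>(a, b, c). [a, b, c] :: 'a list)"
  have set: "set (l t) = triple_set t" for t by (auto simp: triple_set_def l_def)
  have length: "length (l t) = 3" for t by (simp add: l_def split: prod.split)
  have "distinct (concat (map l ts))" using assms by (simp add: triple_points_def l_def)
  then have *: "\<forall>t\<in>set ts. distinct (l t)"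
    "\<forall>s\<in>set ts. \<forall>t\<in>set ts. l s \<noteq> l t \<longrightarrow> set (l s) \<inter> set (l t) = {}"
    unfolding distinct_concat_iff set_map by (simp, blast)
  show "t \<in> set ts \<Longrightarrow> card (triple_set t) = 3"
    using *(1) distinct_card[of "l t"] set[of t] length[of t] by simp
  show "s \<in> set ts \<Longrightarrow> t \<in> set ts \<Longrightarrow> triple_set s \<noteq> triple_set t \<Longrightarrow> triple_set s \<inter> triple_set t = {}"
    using *(2) set[of s] set[of t] by metis
qed

lemma set_triple_pairs:
  assumes "\<And>t. t \<in> set ts \<Longrightarrow> card (triple_set t) = 3"
  shows "(u, v) \<in> set (triple_pairs ts) \<longleftrightarrow> (\<exists>t\<in>set ts. u \<in> triple_set t \<and> v \<in> triple_set t \<and> u \<noteq> v)"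
proof -
  have "(u, v) \<in> set ((\<lambda>(a, b, c). [(a, b), (b, a), (a, c), (c, a), (b, c), (c, b)]) t) \<longleftrightarrow>
      u \<in> triple_set t \<and> v \<in> triple_set t \<and> u \<noteq> v" if t: "t \<in> set ts" for t
  proof -
    obtain a b c where abc: "t = (a, b, c)" by (cases t)
    have "card {a, b, c} = 3" using assms[OF t] by (simp add: abc triple_set_def)
    then have "a \<noteq> b" "a \<noteq> c" "b \<noteq> c" by (auto simp: card_insert_if split: if_splits)
    then show ?thesis by (auto simp: abc triple_set_def)
  qed
  then show ?thesis by (simp add: triple_pairs_def)
qed

text \<open>The method of differences: class \<open>k\<close> is the starter translated by
  \<open>k\<close>. The code of a pair of points is invariant under translation and occurs at
  exactly one pair of the starter, after which \<open>k\<close> is determined modulo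
  \<open>N\<close>. As no difference in the starter is divisible by \<open>n\<close>, its blocks are
  transversal to the groups.\<close>

lemma starter_frame:
  assumes st: "starter n N ts" and n: "n > 0" and N: "N > 0" "n dvd N"
  shows "frame {0..<2 * N} {0..<N} (\<lambda>p. p mod n) {0..<N} (\<lambda>k. k mod n)
    (\<lambda>k. (`) (shift N k) ` triple_set ` set ts)"
proof -
  define E where "E = {z\<in>{0..<2 * N}. z mod n \<noteq> 0}"
  have P: "sort (triple_points ts) = filter (\<lambda>z. z mod n \<noteq> 0) [0..2 * N - 1]"
    and D: "sort (map (diff_code N) (triple_pairs ts)) = filter (\<lambda>z. z mod n \<noteq> 0) [0..4 * N - 1]"
    using st by (simp_all add: starter_def)
  note Pd = sort_eq_filter_upto(1)[OF P]
  have PE: "(\<Union>t\<in>set ts. triple_set t) = E"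
    using sort_eq_filter_upto(2)[OF P] by (auto simp: E_def set_triple_points)
  have injD: "inj_on (diff_code N) (set (triple_pairs ts))"
    using sort_eq_filter_upto(1)[OF D] by (simp only: distinct_map)
  have DE: "diff_code N ` set (triple_pairs ts) = {z\<in>{0..<4 * N}. z mod n \<noteq> 0}"
    using sort_eq_filter_upto(2)[OF D] by auto
  note c3 = distinct_triple_points(1)[OF Pd] and disj = distinct_triple_points(2)[OF Pd]
  note prs = set_triple_pairs[OF c3, of ts]
  have inE: "u \<in> E" "u \<in> {0..<2 * N}" if "u \<in> triple_set t" "t \<in> set ts" for u t
  proof -
    show "u \<in> E" using that PE by blast
    then show "u \<in> {0..<2 * N}" by (simp add: E_def)
  qed
  have dn: "(v - u) mod n \<noteq> 0" if "u \<in> triple_set t" "v \<in> triple_set t" "u \<noteq> v" "t \<in> set ts" for u v t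
  proof -
    have "(u, v) \<in> set (triple_pairs ts)" using prs that by blast
    then have "diff_code N (u, v) \<in> diff_code N ` set (triple_pairs ts)" by (rule imageI)
    then have "diff_code N (u, v) mod n \<noteq> 0" unfolding DE by simp
    then show ?thesis by (simp add: diff_code_mod[OF N(2)])
  qed
  have inj: "inj_on (shift N k) A" for k A using inj_shift[OF N(1)] by (rule inj_on_subset) simp
  show ?thesis
    unfolding frame_def
  proof (intro conjI ballI impI)
    fix k assume k: "k \<in> {0..<N}"
    have "partition_on E (triple_set ` set ts)"
    proof (rule partition_onI)
      show "\<Union> (triple_set ` set ts) = E" using PE by simp
      show "{} \<notin> triple_set ` set ts" using c3 by force
      show "\<And>p q. p \<in> triple_set ` set ts \<Longrightarrow> q \<in> triple_set ` set ts \<Longrightarrow> p \<noteq> q \<Longrightarrow> disjnt p q"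
        unfolding disjnt_def using disj by blast
    qed
    then have "partition_on (shift N k ` E) ((`) (shift N k) ` triple_set ` set ts)"
      by (rule partition_on_image) (rule inj)
    moreover have "shift N k ` E = {p \<in> {0..<2 * N}. p mod n \<noteq> k mod n}"
    proof -
      have *: "shift N k p \<in> {p \<in> {0..<2 * N}. p mod n \<noteq> k mod n} \<longleftrightarrow> p \<in> E" for p
      proof -
        have eq: "(p + k) mod n = k mod n \<longleftrightarrow> p mod n = 0"
          by (simp add: mod_eq_dvd_iff mod_eq_0_iff_dvd)
        show ?thesis
          unfolding E_def mem_Collect_eq shift_range[OF N(1)] shift_mod_dvd[OF N(2)] eq by (rule refl)
      qed
      show ?thesis
      proof (intro equalityI subsetI)
        fix x assume "x \<in> shift N k ` E"
        then show "x \<in> {p \<in> {0..<2 * N}. p mod n \<noteq> k mod n}" using * by blast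
      next
        fix x assume "x \<in> {p \<in> {0..<2 * N}. p mod n \<noteq> k mod n}"
        then have "shift N (- k) x \<in> E" using *[of "shift N (- k) x"] shift_neg[OF N(1), of k x] by simp
        then show "x \<in> shift N k ` E" using shift_neg[OF N(1), of k x] by (metis imageI)
      qed
    qed
    ultimately show "partition_on {p \<in> {0..<2 * N}. p mod n \<noteq> k mod n} ((`) (shift N k) ` triple_set ` set ts)"
      by simp
  next
    fix k b assume k: "k \<in> {0..<N}" and "b \<in> (`) (shift N k) ` triple_set ` set ts"
    then obtain t where t: "t \<in> set ts" "b = shift N k ` triple_set t" by auto
    show "card b = 3" by (simp add: t card_image[OF inj] c3)
    show "inj_on (\<lambda>p. p mod n) b"
    proof (rule inj_onI)
      fix p q assume "p \<in> b" "q \<in> b" "p mod n = q mod n"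
      then obtain u v where u: "u \<in> triple_set t" "v \<in> triple_set t" "p = shift N k u" "q = shift N k v"
        by (auto simp: t)
      have "(u + k) mod n = (v + k) mod n"
        using \<open>p mod n = q mod n\<close> by (simp add: u shift_mod_dvd[OF N(2)])
      then have "n dvd (v + k) - (u + k)" by (simp only: mod_eq_dvd_iff[symmetric])
      then have "(v - u) mod n = 0" by simp
      then have "u = v" using dn[OF u(1,2) _ t(1)] by auto
      then show "p = q" by (simp add: u)
    qed
    fix p q assume pq: "p \<in> b \<inter> {0..<N}" "q \<in> b \<inter> {0..<N}" "p \<noteq> q"
    have low: "shift N k u \<in> {0..<N} \<longleftrightarrow> u < N" if "u \<in> triple_set t" for u
    proof -
      have "x \<in> {0..<N} \<longleftrightarrow> x div N = 0" for x using N(1) by (auto simp: div_pos_pos_trivial zdiv_eq_0_iff)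
      then show ?thesis using inE(2)[OF that t(1)] shift_div[OF N(1), of k u] by auto
    qed
    obtain u v where uv: "u \<in> triple_set t" "v \<in> triple_set t" "p = shift N k u" "q = shift N k v"
      using pq by (auto simp: t)
    obtain a1 a2 a3 where abc: "t = (a1, a2, a3)" by (cases t)
    have "u < N" "v < N" "u \<noteq> v" using uv pq low by auto
    have "(a1 < N \<and> a2 < N \<longrightarrow> a3 < N) \<and> (a1 < N \<and> a3 < N \<longrightarrow> a2 < N) \<and> (a2 < N \<and> a3 < N \<longrightarrow> a1 < N)"
      using st t(1) by (auto simp: starter_def list_all_iff abc)
    moreover have "u = a1 \<or> u = a2 \<or> u = a3" "v = a1 \<or> v = a2 \<or> v = a3"
      using uv(1,2) by (simp_all add: abc triple_set_def)
    ultimately have "a1 < N \<and> a2 < N \<and> a3 < N" using \<open>u < N\<close> \<open>v < N\<close> \<open>u \<noteq> v\<close> by metis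
    then have "\<forall>x\<in>triple_set t. x < N" by (simp add: abc triple_set_def)
    then show "b \<subseteq> {0..<N}" using low by (auto simp: t)
  next
    fix p q assume pq: "p \<in> {0..<2 * N}" "q \<in> {0..<2 * N}" "p mod n \<noteq> q mod n"
    have "diff_code N (p, q) mod n \<noteq> 0"
    proof
      assume "diff_code N (p, q) mod n = 0"
      then have "n dvd q - p" by (simp add: diff_code_mod[OF N(2)] mod_eq_0_iff_dvd)
      then show False using pq(3) by (simp add: mod_eq_dvd_iff[symmetric])
    qed
    then have "diff_code N (p, q) \<in> diff_code N ` set (triple_pairs ts)"
      using diff_code_range[OF N(1) pq(1,2)] by (simp only: DE) simp
    then obtain u v where uv: "(u, v) \<in> set (triple_pairs ts)" "diff_code N (p, q) = diff_code N (u, v)"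
      by auto
    then obtain t where t: "t \<in> set ts" "u \<in> triple_set t" "v \<in> triple_set t" using prs by blast
    have eq: "(q - p) mod N = (v - u) mod N" "p div N = u div N" "q div N = v div N"
      using uv(2) diff_code_eq_iff[OF N(1) pq(1,2) inE(2)[OF t(2,1)] inE(2)[OF t(3,1)]] by simp_all
    define k where "k = (p - u) mod N"
    have k: "k \<in> {0..<N}" using N(1) by (simp add: k_def)
    have "shift N k u = p" by (simp add: shift_def k_def mod_simps eq(2)[symmetric])
    moreover have "shift N k v = q"
    proof -
      have "(v + k) mod N = (p + (v - u)) mod N" by (simp add: k_def mod_simps algebra_simps)
      also have "\<dots> = (p + (q - p)) mod N" using eq(1) by (metis mod_add_right_eq)
      finally show ?thesis by (simp add: shift_def eq(3)[symmetric])
    qed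
    ultimately show "\<exists>k\<in>{0..<N}. \<exists>b\<in>(`) (shift N k) ` triple_set ` set ts. p \<in> b \<and> q \<in> b"
      using k t by (intro bexI[of _ k] bexI[of _ "shift N k ` triple_set t"]) auto
  next
    fix k k' b b' p q
    assume k: "k \<in> {0..<N}" "k' \<in> {0..<N}"
      and b: "b \<in> (`) (shift N k) ` triple_set ` set ts" "b' \<in> (`) (shift N k') ` triple_set ` set ts"
      and p: "p \<in> b \<inter> b'" and q: "q \<in> b \<inter> b'" and "p \<noteq> q"
    obtain s t where s: "s \<in> set ts" "b = shift N k ` triple_set s"
      and t: "t \<in> set ts" "b' = shift N k' ` triple_set t"
      using b by auto
    obtain u v where u: "u \<in> triple_set s" "v \<in> triple_set s" "p = shift N k u" "q = shift N k v"
      using p q s by auto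
    obtain x y where x: "x \<in> triple_set t" "y \<in> triple_set t" "p = shift N k' x" "q = shift N k' y"
      using p q t by auto
    have "diff_code N (u, v) = diff_code N (p, q)"
      by (simp only: u(3,4) diff_code_shift[OF N(1)])
    also have "\<dots> = diff_code N (x, y)"
      by (simp only: x(3,4) diff_code_shift[OF N(1)])
    finally have eq: "diff_code N (u, v) = diff_code N (x, y)" .
    have "u \<noteq> v" "x \<noteq> y" using u(3,4) x(3,4) \<open>p \<noteq> q\<close> by auto
    then have "(u, v) \<in> set (triple_pairs ts)" "(x, y) \<in> set (triple_pairs ts)"
      using prs s(1) t(1) u(1,2) x(1,2) by blast+
    then have "(u, v) = (x, y)"
      using inj_onD[OF injD eq] by simp
    then have "u = x" by simp
    have "shift N k u mod N = shift N k' u mod N" using u(3) x(3) \<open>u = x\<close> by simp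
    then have "(u + k) mod N = (u + k') mod N" by (simp only: shift_mod[OF N(1)])
    then have "N dvd (u + k) - (u + k')" by (simp only: mod_eq_dvd_iff[symmetric])
    then have "k mod N = k' mod N" by (simp add: mod_eq_dvd_iff)
    then show "k = k'" using k by simp
    moreover have "triple_set s = triple_set t" using disj[OF s(1) t(1)] u(1) x(1) \<open>u = x\<close> by blast
    ultimately show "b = b'" using s t by simp
  qed
qed

lemma card_residue:
  fixes n m i :: int
  assumes "0 \<le> i" "i < n" "0 \<le> m"
  shows "card {p\<in>{0..<n * m}. p mod n = i} = nat m"
proof -
  have "bij_betw (\<lambda>t. i + n * t) {0..<m} {p\<in>{0..<n * m}. p mod n = i}"
  proof (rule bij_betw_byWitness[where f' = "\<lambda>p. p div n"])
    show "(\<lambda>t. i + n * t) ` {0..<m} \<subseteq> {p \<in> {0..<n * m}. p mod n = i}"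
    proof clarify
      fix t assume t: "t \<in> {0..<m}"
      then have "n * (t + 1) \<le> n * m" using assms by (intro mult_left_mono) auto
      then have "i + n * t < n * m" using assms by (simp add: distrib_left)
      then show "i + n * t \<in> {0..<n * m} \<and> (i + n * t) mod n = i" using assms t by simp
    qed
    show "(\<lambda>p. p div n) ` {p \<in> {0..<n * m}. p mod n = i} \<subseteq> {0..<m}"
    proof clarify
      fix p assume p: "p \<in> {0..<n * m}"
      have "p div n * n \<le> p" using assms by (simp add: minus_mod_eq_div_mult[symmetric])
      also have "p < m * n" using p by (simp add: mult.commute)
      finally have "p div n < m" using assms by (simp add: mult_less_cancel_right)
      then show "p div n \<in> {0..<m}" using p assms by (simp add: pos_imp_zdiv_nonneg_iff)
    qed
    show "\<forall>p\<in>{p \<in> {0..<n * m}. p mod n = i}. i + n * (p div n) = p" by (auto simp: add.commute)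
  qed (use assms in auto)
  then show ?thesis using bij_betw_same_card by fastforce
qed

lemma has_frame_starter:
  assumes "starter (int n) (int (n * g)) ts" "n > 0" "g > 0"
  shows "has_frame g {..<n}"
proof -
  let ?n = "int n" and ?N = "int (n * g)"
  have N: "?N > 0" "?n dvd ?N" using assms by simp_all
  have fr: "frame {0..<2 * ?N} {0..<?N} (\<lambda>p. p mod ?n) {0..<?N} (\<lambda>k. k mod ?n)
    (\<lambda>k. (`) (shift ?N k) ` triple_set ` set ts)"
    using starter_frame[OF assms(1) _ N] assms(2) by simp
  have "bij_betw nat {0..<?n} {..<n}" by (rule bij_betw_byWitness[where f' = int]) auto
  moreover have "card {p\<in>{0..<?N}. p mod ?n = i} = g" if "i \<in> {0..<?n}" for i
    using card_residue[of i ?n "int g"] that by simp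
  moreover have "card {p\<in>{0..<2 * ?N}. p mod ?n = i} = 2 * g" if "i \<in> {0..<?n}" for i
    using card_residue[of i ?n "2 * int g"] that by (simp add: mult.left_commute nat_mult_distrib)
  ultimately show ?thesis
    using assms(2,3) by (intro has_frameI[OF fr]) auto
qed

section \<open>Explicit frames and group divisible designs\<close>

text \<open>Distinctness of a concatenation makes only unequal lists disjoint and tolerates repeated
  empty ones. The common element \<open>z\<close> shows that the list is nonempty, and nonempty
  lists cannot repeat.\<close>

lemma distinct_concat_map_inj:
  assumes "distinct (concat (map f xs))" "x \<in> set xs" "y \<in> set xs" "z \<in> set (f x)" "z \<in> set (f y)"
  shows "x = y"
proof -
  have "\<forall>ys zs. ys \<in> set (map f xs) \<and> zs \<in> set (map f xs) \<and> ys \<noteq> zs \<longrightarrow> set ys \<inter> set zs = {}"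
    using assms(1) unfolding distinct_concat_iff by (elim conjE)
  from this[rule_format, of "f x" "f y"] have "f x = f y" using assms(2-5) by auto
  moreover have "inj_on f {x\<in>set xs. f x \<noteq> []}"
  proof -
    have "distinct (removeAll [] (map f xs))" using assms(1) by (simp only: distinct_concat_iff)
    also have "removeAll [] (map f xs) = map f (filter (\<lambda>x. f x \<noteq> []) xs)"
      by (induction xs) auto
    finally show ?thesis by (simp add: distinct_map)
  qed
  ultimately show ?thesis using assms(2-) by (auto dest: inj_onD)
qed

text \<open>Concatenated over all blocks, these are the neighbours of \<open>x\<close> with
  multiplicity. If sorting them lists every point of the other groups once, each such pair lies in
  exactly one block.\<close>

definition others :: "'a \<Rightarrow> 'a list \<Rightarrow> 'a list" where
  "others x b = (if x \<in> set b then removeAll x b else [])"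

lemma set_others: "y \<in> set (others x b) \<longleftrightarrow> x \<in> set b \<and> y \<in> set b \<and> x \<noteq> y"
  unfolding others_def by (cases "x \<in> set b") (simp_all, blast)

definition explicit_gdd :: "int \<Rightarrow> int \<Rightarrow> int list list \<Rightarrow> bool" where
  "explicit_gdd n M bs \<longleftrightarrow>
     list_all (\<lambda>x. sort (concat (map (others x) bs)) = filter (\<lambda>y. y mod n \<noteq> x mod n) [0..M - 1])
       [0..M - 1] \<and>
     list_all (\<lambda>b. distinct b \<and> length b = 4 \<and> list_all (\<lambda>x. 0 \<le> x \<and> x < M) b) bs"

text \<open>The instance of \<open>has_frame_gdd\<close> with blocks of size 4, each replaced by a
  copy of one frame. With \<open>t = 1\<close> the groups are single points, as for the affine
  plane.\<close>

lemma has_frame_explicit_gdd: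
  assumes bs: "explicit_gdd (int n) (int (n * t)) bs" and "n > 0" "t > 0" "g > 0"
    and has_frame4: "has_frame g {..<4::nat}"
  shows "has_frame (g * t) {..<n}"
proof -
  define M where "M = int (n * t)"
  have sorted: "sort (concat (map (others x) bs)) = filter (\<lambda>y. y mod int n \<noteq> x mod int n) [0..M - 1]"
    if "0 \<le> x" "x < M" for x
    using bs that by (simp add: explicit_gdd_def M_def list_all_iff)
  have all: "distinct b" "length b = 4" "set b \<subseteq> {0..<M}" if "b \<in> set bs" for b
    using bs that by (auto simp: explicit_gdd_def M_def list_all_iff)
  have nbr: "(\<exists>b\<in>set bs. x \<in> set b \<and> y \<in> set b \<and> x \<noteq> y) \<longleftrightarrow>
      0 \<le> y \<and> y < M \<and> y mod int n \<noteq> x mod int n" if "0 \<le> x" "x < M" for x y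
  proof -
    have "y \<in> set (concat (map (others x) bs)) \<longleftrightarrow> y \<in> {z\<in>{0..M - 1}. z mod int n \<noteq> x mod int n}"
      by (simp only: sort_eq_filter_upto(2)[OF sorted[OF that]])
    then show ?thesis by (auto simp: set_others)
  qed
  have "has_frame (g * t) {0..<int n}"
  proof (rule has_frame_gdd[where \<L> = "set ` set bs" and X = "{0..<M}" and l = "\<lambda>x. x mod int n"])
    fix L assume "L \<in> set ` set bs"
    then obtain b where b: "b \<in> set bs" "L = set b" by auto
    show "L \<subseteq> {0..<M}" using all(3)[OF b(1)] by (simp add: b)
    show "inj_on (\<lambda>x. x mod int n) L"
    proof (rule inj_onI, rule ccontr)
      fix x y assume "x \<in> L" "y \<in> L" "x mod int n = y mod int n" "x \<noteq> y"
      then show False using nbr[of x y] all(3)[OF b(1)] b by fastforce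
    qed
    have "card L = 4" using all(1,2)[OF b(1)] by (simp add: b distinct_card)
    then obtain h where "bij_betw h {..<4::nat} L"
      using ex_bij_betw_nat_finite[of L] b by (auto simp: atLeast0LessThan)
    then show "has_frame g L" by (rule has_frame_bij[OF has_frame4]) (rule assms(4))
  next
    fix x y assume "x \<in> {0..<M}" "y \<in> {0..<M}" "x mod int n \<noteq> y mod int n"
    then have "\<exists>b\<in>set bs. x \<in> set b \<and> y \<in> set b \<and> x \<noteq> y" using nbr[of x y] by auto
    then show "\<exists>L\<in>set ` set bs. x \<in> L \<and> y \<in> L" by blast
  next
    fix x y L L' assume xy: "x \<noteq> y" and "L \<in> set ` set bs" "L' \<in> set ` set bs"
      and m: "x \<in> L" "y \<in> L" "x \<in> L'" "y \<in> L'"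
    then obtain b b' where b: "b \<in> set bs" "L = set b" "b' \<in> set bs" "L' = set b'" by auto
    have "0 \<le> x" "x < M" using all(3)[OF b(1)] m(1) b(2) by auto
    note dist = sort_eq_filter_upto(1)[OF sorted[OF this]]
    have "b = b'"
      by (rule distinct_concat_map_inj[OF dist b(1,3), of y]) (use m xy b in \<open>simp_all add: set_others\<close>)
    then show "L = L'" by (simp add: b)
  next
    show "(\<lambda>x. x mod int n) ` {0..<M} \<subseteq> {0..<int n}" using assms by auto
    fix i assume "i \<in> {0..<int n}"
    then show "card {x \<in> {0..<M}. x mod int n = i} = t"
      using card_residue[of i "int n" "int t"] by (simp add: M_def)
  qed (use assms in auto)
  moreover have "bij_betw nat {0..<int n} {..<n}" by (rule bij_betw_byWitness[where f' = int]) auto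
  ultimately show ?thesis by (rule has_frame_bij) (use assms in simp)
qed

text \<open>A triple with two points below \<open>N\<close> must have its third one there too, which
  is the test \<open>\<noteq> 2\<close>. Without a group action generating the classes, each block
  carries the index of its class.\<close>

definition explicit_frame :: "int \<Rightarrow> int \<Rightarrow> (int \<times> int list) list \<Rightarrow> bool" where
  "explicit_frame n N bs \<longleftrightarrow>
     list_all (\<lambda>k. sort (concat (map snd (filter (\<lambda>b. fst b = k) bs))) =
       filter (\<lambda>z. z mod n \<noteq> k mod n) [0..2 * N - 1]) [0..N - 1] \<and>
     list_all (\<lambda>x. sort (concat (map (others x \<circ> snd) bs)) =
       filter (\<lambda>y. y mod n \<noteq> x mod n) [0..2 * N - 1]) [0..2 * N - 1] \<and>
     list_all (\<lambda>(k, b). 0 \<le> k \<and> k < N \<and> distinct b \<and> length b = 3 \<and>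
       length (filter (\<lambda>x. x < N) b) \<noteq> 2) bs"

lemma has_frame_explicit_frame:
  assumes bs: "explicit_frame (int n) (int (n * g)) bs" and "n > 0" "g > 0"
  shows "has_frame g {..<n}"
proof -
  define N where "N = int (n * g)"
  define cls where "cls k = filter (\<lambda>b. fst b = k) bs" for k
  have P: "sort (concat (map snd (cls k))) = filter (\<lambda>z. z mod int n \<noteq> k mod int n) [0..2 * N - 1]"
    if "k \<in> {0..<N}" for k
    using bs that unfolding explicit_frame_def N_def[symmetric] cls_def by (simp add: list_all_iff)
  have D: "sort (concat (map (others x \<circ> snd) bs)) = filter (\<lambda>y. y mod int n \<noteq> x mod int n) [0..2 * N - 1]"
    if "0 \<le> x" "x < 2 * N" for x
    using bs that unfolding explicit_frame_def N_def[symmetric] by (simp add: list_all_iff)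
  have all: "k \<in> {0..<N}" "distinct b" "length b = 3" "length (filter (\<lambda>x. x < N) b) \<noteq> 2"
    if "(k, b) \<in> set bs" for k b
    using bs that unfolding explicit_frame_def N_def[symmetric] by (auto simp: list_all_iff)
  have cls: "(k', b) \<in> set (cls k) \<longleftrightarrow> k' = k \<and> (k, b) \<in> set bs" for k k' b by (auto simp: cls_def)
  have cover: "(\<Union>b\<in>set (cls k). set (snd b)) = {z\<in>{0..<2 * N}. z mod int n \<noteq> k mod int n}"
    if "k \<in> {0..<N}" for k
    using sort_eq_filter_upto(2)[OF P[OF that]] by auto
  have range: "0 \<le> x" "x < 2 * N" if "(k, b) \<in> set bs" "x \<in> set b" for k b x
  proof -
    have "(k, b) \<in> set (cls k)" using that cls by simp
    then have "x \<in> {z\<in>{0..<2 * N}. z mod int n \<noteq> k mod int n}"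
      using cover[OF all(1)[OF that(1)]] that(2) by force
    then show "0 \<le> x" "x < 2 * N" by simp_all
  qed
  have nbr: "(\<exists>b\<in>set bs. x \<in> set (snd b) \<and> y \<in> set (snd b) \<and> x \<noteq> y) \<longleftrightarrow>
      0 \<le> y \<and> y < 2 * N \<and> y mod int n \<noteq> x mod int n" if "0 \<le> x" "x < 2 * N" for x y
  proof -
    have "y \<in> set (concat (map (others x \<circ> snd) bs)) \<longleftrightarrow> y \<in> {z\<in>{0..2 * N - 1}. z mod int n \<noteq> x mod int n}"
      by (simp only: sort_eq_filter_upto(2)[OF D[OF that]])
    then show ?thesis by (auto simp: set_others)
  qed
  have fr: "frame {0..<2 * N} {0..<N} (\<lambda>p. p mod int n) {0..<N} (\<lambda>k. k mod int n)
      (\<lambda>k. (set \<circ> snd) ` set (cls k))"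
    unfolding frame_def
  proof (intro conjI ballI impI)
    fix k assume k: "k \<in> {0..<N}"
    note dist = sort_eq_filter_upto(1)[OF P[OF k]]
    show "partition_on {p \<in> {0..<2 * N}. p mod int n \<noteq> k mod int n} ((set \<circ> snd) ` set (cls k))"
    proof (rule partition_onI)
      show "\<Union> ((set \<circ> snd) ` set (cls k)) = {p \<in> {0..<2 * N}. p mod int n \<noteq> k mod int n}"
        using cover[OF k] by simp
      have "b \<noteq> []" if "(k, b) \<in> set bs" for b using all(3)[OF that] by auto
      then show "{} \<notin> (set \<circ> snd) ` set (cls k)" using cls by fastforce
      fix A B assume "A \<in> (set \<circ> snd) ` set (cls k)" "B \<in> (set \<circ> snd) ` set (cls k)" "A \<noteq> B"
      then obtain a b where ab: "a \<in> set (cls k)" "b \<in> set (cls k)" "A = set (snd a)" "B = set (snd b)" by auto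
      show "disjnt A B" unfolding disjnt_iff
      proof (intro allI notI, elim conjE)
        fix x assume "x \<in> A" "x \<in> B"
        then have "a = b" using distinct_concat_map_inj[OF dist ab(1,2), of x] ab by simp
        then show False using \<open>A \<noteq> B\<close> ab by simp
      qed
    qed
  next
    fix k B assume k: "k \<in> {0..<N}" and "B \<in> (set \<circ> snd) ` set (cls k)"
    then obtain b where b: "(k, b) \<in> set bs" "B = set b" using cls by auto
    show "card B = 3" using all(2,3)[OF b(1)] by (simp add: b distinct_card)
    show "inj_on (\<lambda>p. p mod int n) B"
    proof (rule inj_onI, rule ccontr)
      fix x y assume xy: "x \<in> B" "y \<in> B" "x mod int n = y mod int n" "x \<noteq> y"
      have "\<exists>b\<in>set bs. x \<in> set (snd b) \<and> y \<in> set (snd b) \<and> x \<noteq> y"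
        by (rule bexI[OF _ b(1)]) (use xy b in simp)
      then show False using nbr[of x y] range[OF b(1)] xy b(2) by simp
    qed
    fix p q assume pq: "p \<in> B \<inter> {0..<N}" "q \<in> B \<inter> {0..<N}" "p \<noteq> q"
    let ?low = "filter (\<lambda>x. x < N) b"
    have "card {p, q} \<le> card (set ?low)" by (rule card_mono) (use pq b in auto)
    then have "2 \<le> length ?low" using pq(3) card_length[of ?low] by simp
    moreover have "length ?low < 3" if "x \<in> B" "\<not> x < N" for x
      using length_filter_less[of x b "\<lambda>x. x < N"] that all(3)[OF b(1)] b by simp
    ultimately have "x < N" if "x \<in> B" for x using all(4)[OF b(1)] that by fastforce
    then show "B \<subseteq> {0..<N}" using range(1)[OF b(1)] by (auto simp: b)
  next
    fix p q assume "p \<in> {0..<2 * N}" "q \<in> {0..<2 * N}" "p mod int n \<noteq> q mod int n"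
    then have "\<exists>b\<in>set bs. p \<in> set (snd b) \<and> q \<in> set (snd b) \<and> p \<noteq> q" using nbr[of p q] by auto
    then obtain k b where b: "(k, b) \<in> set bs" "p \<in> set b" "q \<in> set b" by auto
    have "k \<in> {0..<N}" "(k, b) \<in> set (cls k)" using all(1)[OF b(1)] b(1) cls by auto
    then show "\<exists>k\<in>{0..<N}. \<exists>B\<in>(set \<circ> snd) ` set (cls k). p \<in> B \<and> q \<in> B"
      using b(2,3) by (intro bexI[of _ k] bexI[of _ "set b"] conjI image_eqI[of _ _ "(k, b)"]) auto
  next
    fix k k' B B' p q
    assume k: "k \<in> {0..<N}" "k' \<in> {0..<N}" and "B \<in> (set \<circ> snd) ` set (cls k)" "B' \<in> (set \<circ> snd) ` set (cls k')"
      and p: "p \<in> B \<inter> B'" "q \<in> B \<inter> B'" "p \<noteq> q"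
    then obtain b b' where b: "(k, b) \<in> set bs" "B = set b" "(k', b') \<in> set bs" "B' = set b'"
      using cls by auto
    have "0 \<le> p" "p < 2 * N" using range[OF b(1)] p(1) b(2) by auto
    note dist = sort_eq_filter_upto(1)[OF D[OF this]]
    have "(k, b) = (k', b')"
      by (rule distinct_concat_map_inj[OF dist b(1,3), of q]) (use p b in \<open>simp_all add: set_others\<close>)
    then show "k = k'" "B = B'" by (simp_all add: b)
  qed
  have "bij_betw nat {0..<int n} {..<n}" by (rule bij_betw_byWitness[where f' = int]) auto
  moreover have "card {p\<in>{0..<N}. p mod int n = i} = g" if "i \<in> {0..<int n}" for i
    using card_residue[of i "int n" "int g"] that by (simp add: N_def)
  moreover have "card {p\<in>{0..<2 * N}. p mod int n = i} = 2 * g" if "i \<in> {0..<int n}" for i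
    using card_residue[of i "int n" "2 * int g"] that by (simp add: N_def mult.left_commute nat_mult_distrib)
  ultimately show ?thesis
    using assms(2,3) by (intro has_frameI[OF fr]) auto
qed

section \<open>Data for the small cases\<close>

text \<open>A \<open>(25,4,1)\<close>-design, developed over the elementary abelian group of order 25, with one point
  removed; the groups come from the blocks through that point.\<close>

lemma explicit_gdd_8: "explicit_gdd 8 24
   [[0,4,6,13], [4,5,19,23], [1,5,12,14], [8,13,14,20], [2,13,17,19], [10,12,16,19], [6,9,12,21],
    [8,9,22,23], [7,14,17,21], [16,17,18,22], [6,15,16,20], [2,3,6,23], [10,11,14,23],
    [3,4,21,22], [5,11,20,22], [1,2,7,20], [0,10,15,21], [0,7,11,12], [4,7,9,18], [5,8,15,18],
    [1,3,13,15], [0,2,5,9], [1,4,8,10], [0,1,19,22], [6,7,8,19], [12,13,18,23], [9,14,15,19],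
    [3,8,12,17], [9,11,13,16], [2,4,14,16], [5,6,10,17], [1,16,21,23], [0,17,20,23],
    [18,19,20,21], [2,12,15,22], [3,9,10,20], [2,8,11,21], [7,10,13,22], [3,5,7,16], [1,6,11,18],
    [0,3,14,18], [4,11,15,17]]"
  by code_simp

text \<open>The affine plane of order 4.\<close>

lemma explicit_gdd_16: "explicit_gdd 16 16
   [[0,4,8,12], [1,5,9,13], [2,6,10,14], [3,7,11,15], [0,5,10,15], [1,4,11,14], [2,7,8,13],
    [3,6,9,12], [0,6,11,13], [1,7,10,12], [2,4,9,15], [3,5,8,14], [0,7,9,14], [1,6,8,15],
    [2,5,11,12], [3,4,10,13], [0,1,2,3], [4,5,6,7], [8,9,10,11], [12,13,14,15]]"
  by code_simp

text \<open>Developed over the product of two cyclic groups of order 4; a cyclic starter does not exist here.\<close>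

lemma explicit_frame_4: "explicit_frame 4 16
   [(0,[2,11,13]), (0,[1,3,6]), (0,[10,21,23]), (0,[9,19,30]), (0,[14,25,31]), (0,[5,26,27]),
    (0,[7,22,29]), (0,[15,18,17]), (1,[3,14,8]), (1,[4,6,7]), (1,[11,16,18]), (1,[12,22,31]),
    (1,[15,28,26]), (1,[0,27,30]), (1,[2,23,24]), (1,[10,19,20]), (2,[8,1,15]), (2,[3,9,12]),
    (2,[0,23,29]), (2,[11,25,20]), (2,[4,27,21]), (2,[7,16,17]), (2,[13,28,31]), (2,[5,24,19]),
    (3,[9,4,10]), (3,[6,12,13]), (3,[1,18,24]), (3,[14,28,21]), (3,[5,30,16]), (3,[2,17,20]),
    (3,[8,29,26]), (3,[0,25,22]), (4,[6,15,9]), (4,[5,7,2]), (4,[14,17,19]), (4,[13,23,26]),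
    (4,[10,29,27]), (4,[1,30,31]), (4,[3,18,25]), (4,[11,22,21]), (5,[7,10,12]), (5,[0,2,3]),
    (5,[15,20,22]), (5,[8,18,27]), (5,[11,24,30]), (5,[4,31,26]), (5,[6,19,28]), (5,[14,23,16]),
    (6,[12,5,11]), (6,[7,13,8]), (6,[4,19,25]), (6,[15,29,16]), (6,[0,31,17]), (6,[3,20,21]),
    (6,[9,24,27]), (6,[1,28,23]), (7,[13,0,14]), (7,[2,8,9]), (7,[5,22,28]), (7,[10,24,17]),
    (7,[1,26,20]), (7,[6,21,16]), (7,[12,25,30]), (7,[4,29,18]), (8,[10,3,5]), (8,[9,11,14]),
    (8,[2,29,31]), (8,[1,27,22]), (8,[6,17,23]), (8,[13,18,19]), (8,[15,30,21]), (8,[7,26,25]),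
    (9,[11,6,0]), (9,[12,14,15]), (9,[3,24,26]), (9,[4,30,23]), (9,[7,20,18]), (9,[8,19,22]),
    (9,[10,31,16]), (9,[2,27,28]), (10,[0,9,7]), (10,[11,1,4]), (10,[8,31,21]), (10,[3,17,28]),
    (10,[12,19,29]), (10,[15,24,25]), (10,[5,20,23]), (10,[13,16,27]), (11,[1,12,2]),
    (11,[14,4,5]), (11,[9,26,16]), (11,[6,20,29]), (11,[13,22,24]), (11,[10,25,28]),
    (11,[0,21,18]), (11,[8,17,30]), (12,[14,7,1]), (12,[13,15,10]), (12,[6,25,27]),
    (12,[5,31,18]), (12,[2,21,19]), (12,[9,22,23]), (12,[11,26,17]), (12,[3,30,29]),
    (13,[15,2,4]), (13,[8,10,11]), (13,[7,28,30]), (13,[0,26,19]), (13,[3,16,22]),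
    (13,[12,23,18]), (13,[14,27,20]), (13,[6,31,24]), (14,[4,13,3]), (14,[15,5,0]),
    (14,[12,27,17]), (14,[7,21,24]), (14,[8,23,25]), (14,[11,28,29]), (14,[1,16,19]),
    (14,[9,20,31]), (15,[5,8,6]), (15,[10,0,1]), (15,[13,30,20]), (15,[2,16,25]), (15,[9,18,28]),
    (15,[14,29,24]), (15,[4,17,22]), (15,[12,21,26])]"
  by code_simp

text \<open>Here \<open>60 = 5 * 12\<close>: this starter and the next have full size
  \<open>g = 12\<close> and need no inflation.\<close>

lemma starter_5: "starter 5 60
   [(3,16,17), (7,14,18), (9,27,36), (12,46,49), (13,21,57), (24,41,53), (28,34,56), (33,52,54),
    (38,81,82), (59,96,98), (47,68,71), (1,74,78), (31,73,79), (48,102,109), (42,106,114),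
    (43,92,101), (37,113,64), (32,91,103), (51,104,117), (11,93,107), (26,67,83), (23,112,69),
    (2,76,94), (39,118,77), (44,111,72), (19,66,88), (6,99,62), (22,84,108), (29,97,63),
    (8,119,86), (58,61,89), (4,87,116)]"
  by code_simp

lemma starter_6: "starter 6 72
   [(1,16,45), (2,4,53), (3,55,64), (5,31,44), (10,15,50), (13,35,38), (17,62,70), (20,27,61),
    (25,29,39), (40,41,57), (65,74,75), (32,79,81), (47,88,91), (11,118,122), (51,140,73),
    (21,106,113), (43,99,107), (56,127,136), (59,142,80), (49,112,123), (71,116,129), (63,86,100),
    (14,139,82), (69,85,101), (52,111,128), (19,98,117), (46,77,97), (8,109,130), (28,143,93),
    (58,110,133), (33,94,119), (22,95,121), (34,134,89), (26,103,131), (23,135,92), (37,124,83),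
    (67,105,137), (9,115,76), (68,125,87), (7,141,104)]"
  by code_simp

text \<open>From here on \<open>g = 3\<close>, \<open>n\<close> is odd, and inflation by 4
  follows.\<close>

lemma starter_7: "starter 7 21
   [(1,4,17), (2,11,12), (9,13,15), (16,24,25), (19,41,22), (18,33,36), (8,27,31), (3,29,34),
    (6,38,23), (20,32,40), (5,30,39), (10,37,26)]"
  by code_simp

lemma starter_9: "starter 9 27
   [(1,5,26), (2,16,21), (7,8,23), (12,19,22), (11,49,50), (15,30,32), (3,35,38), (25,47,51),
    (14,37,42), (20,34,40), (24,48,28), (6,31,39), (13,43,53), (4,41,52), (10,44,29), (17,33,46)]"
  by code_simp

lemma starter_11: "starter 11 33
   [(1,15,21), (2,7,23), (8,18,26), (9,12,13), (20,27,29), (6,37,38), (31,47,49), (4,64,34),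
    (32,35,39), (5,52,57), (3,59,65), (16,54,61), (17,43,51), (19,60,36), (30,40,50), (28,41,53),
    (10,45,58), (14,42,56), (24,48,63), (25,46,62)]"
  by code_simp

lemma starter_13: "starter 13 39
   [(3,4,34), (7,27,30), (9,16,33), (10,14,35), (11,17,22), (19,29,31), (23,70,71), (6,64,66),
    (15,69,72), (5,41,45), (20,49,54), (8,61,67), (28,51,58), (21,77,46), (25,53,62), (38,40,50),
    (12,44,55), (36,74,47), (37,68,43), (2,48,63), (24,57,73), (32,59,76), (18,42,60), (1,56,75)]"
  by code_simp

lemma starter_15: "starter 15 45
   [(2,19,21), (4,16,41), (6,11,17), (8,37,44), (10,20,23), (12,35,36), (22,26,40), (1,86,87),
    (27,71,73), (38,88,46), (14,57,61), (34,51,56), (25,48,54), (5,78,85), (13,69,77), (9,58,67),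
    (24,79,89), (39,70,81), (3,62,74), (31,55,68), (18,52,66), (28,82,53), (42,63,80), (29,47,65),
    (43,76,50), (7,64,84), (32,83,59), (33,72,49)]"
  by code_simp

lemma starter_17: "starter 17 51
   [(1,23,33), (3,45,46), (4,18,29), (5,20,50), (6,9,44), (8,39,41), (15,19,42), (31,38,43),
    (11,81,82), (16,55,57), (25,100,52), (12,65,69), (2,56,61), (27,83,89), (26,91,98), (7,96,53),
    (22,71,80), (32,95,54), (30,63,74), (35,58,70), (37,79,92), (36,62,76), (40,72,87), (28,94,59),
    (14,75,93), (49,78,97), (48,64,84), (24,67,88), (47,77,99), (13,101,73), (21,66,90),
    (10,86,60)]"
  by code_simp

lemma starter_19: "starter 19 57
   [(5,46,40), (35,37,52), (17,31,22), (2,47,36), (14,44,24), (41,23,54), (10,43,11), (13,16,20),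
    (34,55,26), (1,100,88), (7,73,103), (49,112,94), (4,85,60), (28,82,78), (25,61,90), (6,107,67),
    (42,65,70), (9,113,91), (12,104,71), (27,101,98), (18,80,59), (30,102,79), (39,87,97),
    (45,96,109), (3,89,58), (21,110,64), (33,86,106), (8,111,68), (56,93,77), (50,81,83),
    (15,92,84), (48,74,75), (51,62,69), (29,108,99), (32,72,66), (53,105,63)]"
  by code_simp

lemma starter_23: "starter 23 69
   [(3,37,47), (4,11,19), (9,22,27), (12,45,62), (13,25,53), (15,54,68), (21,43,52), (28,48,49),
    (29,40,66), (32,56,59), (38,42,44), (17,75,76), (50,102,104), (33,80,83), (26,126,130),
    (51,73,78), (24,94,100), (5,111,118), (18,117,125), (20,98,107), (1,99,109), (14,123,134),
    (30,93,105), (31,95,108), (2,70,84), (7,72,87), (41,127,74), (61,86,103), (39,106,124),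
    (36,110,129), (10,120,71), (67,112,133), (55,128,81), (6,135,90), (63,91,116), (8,132,89),
    (65,121,79), (64,85,113), (34,122,82), (35,136,97), (16,88,119), (57,114,77), (58,137,101),
    (60,131,96)]"
  by code_simp

section \<open>The spectrum\<close>

lemma admissible_starter:
  assumes "starter (int n) (int (n * g)) ts" "rtd3 m v" "g * m = 12" "n > 0"
  shows "admissible n"
proof -
  have "g > 0" "m > 0" using assms(3) by (auto intro: Nat.gr0I)
  then show ?thesis
    using has_frame_inflate[OF has_frame_starter[OF assms(1,4)] assms(2)] assms(3) by (simp add: admissible_def)
qed

lemma has_frame_4_4: "has_frame 4 {..<4::nat}"
  by (rule has_frame_explicit_frame[of 4 4]) (use explicit_frame_4 in simp_all)

lemma admissible_base: "admissible 4" "admissible 5" "admissible 6" "admissible 7" "admissible 8" "admissible 9" "admissible 11" "admissible 13"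
  "admissible 15" "admissible 16" "admissible 17" "admissible 19" "admissible 23"
proof -
  show 4: "admissible 4"
    using has_frame_inflate[OF has_frame_4_4 rtd3_3] by (simp add: admissible_def)
  show "admissible 5" "admissible 6"
    using has_frame_starter[of 5 12] has_frame_starter[of 6 12] starter_5 starter_6 by (simp_all add: admissible_def)
  show "admissible 8"
    using has_frame_explicit_gdd[of 8 3 _ 4] explicit_gdd_8 has_frame_4_4 by (simp add: admissible_def)
  show "admissible 16"
    using has_frame_explicit_gdd[of 16 1 _ 12] explicit_gdd_16 4 by (simp add: admissible_def)
  show "admissible 7" "admissible 9" "admissible 11" "admissible 13" "admissible 15" "admissible 17" "admissible 19" "admissible 23"
    by (rule admissible_starter[OF _ rtd3_4, where g = 3];
        use starter_7 starter_9 starter_11 starter_13 starter_15 starter_17 starter_19 starter_23 in simp)+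
qed

text \<open>Out of reach of \<open>admissible_td6\<close>: \<open>m = 7\<close> gives at most 43,
  and \<open>m = 11\<close> would need a group of size 2 or 3, or of size 12 with the extra point.
  Instead the eight columns modulo 7 are cut to six full ones, one of size 5 and an empty one:
  \<open>6 * 7 + 5 = 47\<close>.\<close>

lemma admissible_47: "admissible 47"
proof -
  define sz where "sz = (\<lambda>j::nat. if j < 6 then 7 else if j = 6 then 5 else 0::nat)"
  have "admissible ((\<Sum>j\<le>7. sz j) + 0)"
  proof (rule admissible_td[where m = 7])
    show "coprime d 7" if "0 < d" "d < 7" for d :: nat
    proof -
      have "\<not> 7 dvd d" using that by (auto dest: dvd_imp_le)
      then have "coprime 7 d" by (intro prime_imp_coprime) simp_all
      then show ?thesis by (simp only: coprime_commute)
    qed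
    show "admissible q" if "4 \<le> q" "q \<le> Suc 7" for q
    proof -
      have "q = 4 \<or> q = 5 \<or> q = 6 \<or> q = 7 \<or> q = 8" using that by auto
      then show ?thesis using admissible_base by auto
    qed
  qed (use admissible_base admissible_0 in \<open>auto simp: sz_def\<close>)
  moreover have "{..7} = {0, 1, 2, 3, 4, 5, 6, 7::nat}" by auto
  ultimately show ?thesis by (simp add: sz_def)
qed

text \<open>Entries are \<open>(m, a, b, e)\<close>; they realise 20, 21, ..., 106 except 23 and 47.\<close>

lemma admissible_td6_table:
  "list_all (\<lambda>(m, a, b, e). admissible (4 * m + a + b + e))
    [(5,0,0,0), (5,1,0,0), (5,1,1,0), (5,4,0,0), (5,5,0,0), (5,5,1,0), (5,3,3,1), (5,4,4,0),
    (5,5,4,0), (5,5,5,0), (5,5,5,1), (7,4,0,0), (7,5,0,0), (7,6,0,0), (7,7,0,0), (7,7,1,0),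
    (7,5,4,0), (7,6,4,0), (7,7,4,0), (7,7,5,0), (7,7,6,0), (7,7,7,0), (7,7,7,1), (11,0,0,0),
    (11,1,0,0), (11,1,1,0), (11,4,0,0), (11,5,0,0), (11,6,0,0), (11,7,0,0), (11,8,0,0),
    (11,9,0,0), (11,9,1,0), (11,11,0,0), (11,11,1,0), (11,9,4,0), (11,9,5,0), (11,11,4,0),
    (11,11,5,0), (11,11,6,0), (11,11,7,0), (11,11,8,0), (11,11,9,0), (13,13,0,0), (11,11,11,0),
    (13,11,4,0), (13,11,5,0), (13,13,4,0), (13,13,5,0), (13,13,6,0), (13,13,7,0), (13,13,8,0),
    (13,13,9,0), (17,7,0,0), (13,13,11,0), (17,9,0,0), (13,13,13,0), (17,11,0,0), (17,11,1,0),
    (17,13,0,0), (17,13,1,0), (17,15,0,0), (17,16,0,0), (17,17,0,0), (17,17,1,0), (17,15,4,0),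
    (17,16,4,0), (17,17,4,0), (17,17,5,0), (17,17,6,0), (17,17,7,0), (17,17,8,0), (17,17,9,0),
    (17,16,11,0), (17,17,11,0), (17,16,13,0), (17,17,13,0), (17,16,15,0), (17,17,15,0),
    (17,17,16,0), (17,17,17,0), (19,19,8,0), (19,19,9,0), (19,16,13,0), (19,19,11,0)]"
  unfolding list.pred_inject prod.case
  by (intro conjI TrueI admissible_td6) (simp_all add: admissible_base admissible_0 admissible_1)

lemma admissible_small:
  assumes "4 \<le> n" "n < 107" "n \<notin> {10, 12, 14, 18}"
  shows "admissible n"
proof -
  have "\<forall>n\<in>set [4..<107]. n \<in> {10, 12, 14, 18} \<or> admissible n"
    using admissible_td6_table admissible_base admissible_47 by simp
  moreover have "n \<in> set [4..<107]" using assms(1,2) by (simp only: set_upt atLeastLessThan_iff)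
  ultimately show ?thesis using assms(3) by blast
qed

lemma admissible_all:
  assumes "4 \<le> n" "n \<notin> {10, 12, 14, 18}"
  shows "admissible n"
  using assms
proof (induction n rule: less_induct)
  case (less n)
  show ?case
  proof (cases "n < 107")
    case True
    then show ?thesis using admissible_small less.prems by blast
  next
    case False
    \<comment> \<open>Now \<open>n - 4 * q\<close> is between 19 and 22, and lowering
      \<open>q\<close> by at most 3 keeps \<open>c\<close> between 19 and 34. The bound 107 is where
      \<open>q\<close> reaches 22, so that \<open>m \<ge> 19\<close>, the largest size to which a
      group is truncated here.\<close>
    define q where "q = (n - 19) div 4"
    have q: "22 \<le> q" "4 * q + 19 \<le> n" "n < 4 * q + 23" using False by (auto simp: q_def)
    obtain m where m: "q \<le> m + 3" "m \<le> q" "odd m" "\<not> 3 dvd m"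
    proof -
      \<comment> \<open>Numbers not coprime to 6 come in runs of at most three (2, 3, 4 modulo 6),
        so four consecutive numbers always contain a suitable one.\<close>
      have "\<exists>i\<le>3. odd (q - i) \<and> \<not> 3 dvd (q - i)" using q(1) by presburger
      then obtain i where "i \<le> 3" "odd (q - i)" "\<not> 3 dvd (q - i)" by blast
      then show ?thesis using that[of "q - i"] by simp
    qed
    define c where "c = n - 4 * m"
    have c: "19 \<le> c" "c \<le> 34" "n = 4 * m + c" using q m by (auto simp: c_def)
    have m19: "19 \<le> m" using q m by simp
    have "admissible m" using m m19 q by (intro less.IH) auto
    \<comment> \<open>With \<open>a = 15\<close> the rest \<open>c - a\<close> ranges over 4 to 19;
      if it hits one of the four exceptions, \<open>a = 16\<close> moves it to 9, 11, 13 or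
      17.\<close>
    define a :: nat where "a = (if c - 15 \<in> {10, 12, 14, 18} then 16 else 15)"
    have a: "admissible a" "a \<le> m" using admissible_base m19 by (auto simp: a_def)
    have b: "4 \<le> c - a" "c - a \<le> 19" "c - a \<notin> {10, 12, 14, 18}" "a \<le> c"
      using c by (auto simp: a_def)
    then have "admissible (c - a)" by (intro admissible_small) auto
    then have "admissible (4 * m + a + (c - a) + 0)"
      using a b m m19 \<open>admissible m\<close> admissible_base by (intro admissible_td6) auto
    then show ?thesis using c b by simp
  qed
qed

theorem theorem3p8:
  fixes n :: nat
  assumes "n \<ge> 4" and "n \<notin> {6, 10, 12, 14, 18, 26, 30}"
  shows "\<exists>(X :: nat set) V B Y W A.
           kirkman_frame 24 n X V B \<and>
           gdd3 12 n Y W A \<and>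
           contains_subdesign n V B W A"
proof -
  have "has_frame 12 {..<n}" using admissible_all[of n] assms by (simp add: admissible_def)
  then show ?thesis by (rule contains_subdesign_if_has_frame) (use assms in simp)
qed

end
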